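(* Let $Q(y|x)$ be an irreducible transition matrix on $\mathbb Z_d=\{0,\dots,d-1\}$, let $s_0\in\mathbb Z_d$ be an initial state, and consider the additive Markovian channel $W(Q)^n$. Assume $V(Q)>0$. Then for every real $a$ and every $0<\epsilon<1$, \[ C_p^{\mathrm{AM}}(a\mid Q)=G\big(a/\sqrt{V(Q)}\big),\qquad C^{\mathrm{AM}}(\epsilon\mid Q)=\sqrt{V(Q)}\,G^{-1}(\epsilon). \]
   Context: Arithmetic is mod $d$. For $x,y\in\mathbb Z_d^n$, $W(Q)^n(y|x)=\prod_{i=1}^nQ(y_i-x_i\mid y_{i-1}-x_{i-1})$ with $y_0-x_0:=s_0$; equivalently $W(Q)^n(y|x)=Q^n(y-x)$ where $Q^n(z)=\prod_{i=1}^nQ(z_i|z_{i-1})$, $z_0=s_0$. $P_Q$ is the stationary distribution of $Q$, $H(Q)=\sum_xP_Q(x)H(Q(\cdot|x))$ (Shannon entropy, natural log), and $C_Q^{\mathrm{AM}}=\log d-H(Q)$. $V(Q)$ denotes the asymptotic variance $\lim_{n\to\infty}\frac1n\mathrm{Var}_{Q^n}(-\log Q^n(Z))$ of the Markov chain's log-likelihood (the paper writes it as $\sum_{y,x}Q(y|x)P_Q(x)(-\log Q(y|x)-H(Q))^2+2\sum_{z,y,x}Q(z|y)Q(y|x)P_Q(x)(-\log Q(z|y)-H(Q))(-\log Q(y|x)-H(Q))$). A code for $W(Q)^n$ is $\Phi=(N,\phi,\{\mathcal D_i\})$, $\phi:\{1..N\}\to\mathbb Z_d^n$, disjoint $\mathcal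 D_i\subset\mathbb Z_d^n$, $|\Phi|=N$, $P_e(\Phi)=\frac1N\sum_i(1-W(Q)^n_{\phi(i)}(\mathcal D_i))$. Over all code sequences: $C_p^{\mathrm{AM}}(a|Q)=\inf\{\limsup_nP_e(\Phi_n):\liminf_n\frac1{\sqrt n}(\log|\Phi_n|-nC_Q^{\mathrm{AM}})\ge a\}$, $C^{\mathrm{AM}}(\epsilon|Q)=\sup\{\liminf_n\frac1{\sqrt n}(\log|\Phi_n|-nC^{\mathrm{AM}}_Q):\limsup_nP_e(\Phi_n)\le\epsilon\}$. $G$ is the standard normal distribution function. *)

theory Defs
  imports "HOL-Probability.Probability"
begin

text \<open>States of Z_d are the naturals 0..d-1. A transition matrix is Q :: nat => nat => real
  with Q y x = Q(y|x). Words of length n are functions in {0..<n} ->E {0..<d};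
  paper index i (1..n) corresponds to index i-1 here.\<close>

definition stoch_matrix :: "nat \<Rightarrow> (nat \<Rightarrow> nat \<Rightarrow> real) \<Rightarrow> bool" where
  "stoch_matrix d Q \<longleftrightarrow> (\<forall>x<d. (\<forall>y<d. Q y x \<ge> 0) \<and> (\<Sum>y<d. Q y x) = 1)"

fun mat_pow :: "nat \<Rightarrow> (nat \<Rightarrow> nat \<Rightarrow> real) \<Rightarrow> nat \<Rightarrow> nat \<Rightarrow> nat \<Rightarrow> real" where
  "mat_pow d Q 0 y x = (if y = x then 1 else 0)"
| "mat_pow d Q (Suc k) y x = (\<Sum>z<d. Q y z * mat_pow d Q k z x)"

definition irreducible_tm :: "nat \<Rightarrow> (nat \<Rightarrow> nat \<Rightarrow> real) \<Rightarrow> bool" where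
  "irreducible_tm d Q \<longleftrightarrow> stoch_matrix d Q \<and>
     (\<forall>x<d. \<forall>y<d. \<exists>k>0. mat_pow d Q k y x > 0)"

definition stationary :: "nat \<Rightarrow> (nat \<Rightarrow> nat \<Rightarrow> real) \<Rightarrow> (nat \<Rightarrow> real) \<Rightarrow> bool" where
  "stationary d Q P \<longleftrightarrow> (\<forall>x<d. P x \<ge> 0) \<and> (\<Sum>x<d. P x) = 1 \<and>
     (\<forall>y<d. (\<Sum>x<d. Q y x * P x) = P y)"

text \<open>The stationary distribution P_Q (unique for irreducible Q).\<close>
definition stat_dist :: "nat \<Rightarrow> (nat \<Rightarrow> nat \<Rightarrow> real) \<Rightarrow> nat \<Rightarrow> real" where
  "stat_dist d Q = (THE P. stationary d Q P \<and> (\<forall>x. x \<ge> d \<longrightarrow> P x = 0))"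

definition entropy_rate :: "nat \<Rightarrow> (nat \<Rightarrow> nat \<Rightarrow> real) \<Rightarrow> real" where
  "entropy_rate d Q = (\<Sum>x<d. stat_dist d Q x * (\<Sum>y<d. - Q y x * ln (Q y x)))"

definition cap_AM :: "nat \<Rightarrow> (nat \<Rightarrow> nat \<Rightarrow> real) \<Rightarrow> real" where
  "cap_AM d Q = ln (real d) - entropy_rate d Q"

definition words :: "nat \<Rightarrow> nat \<Rightarrow> (nat \<Rightarrow> nat) set" where
  "words d n = {0..<n} \<rightarrow>\<^sub>E {0..<d}"

definition markov_prob :: "(nat \<Rightarrow> nat \<Rightarrow> real) \<Rightarrow> nat \<Rightarrow> nat \<Rightarrow> (nat \<Rightarrow> nat) \<Rightarrow> real" where
  "markov_prob Q s0 n z = (\<Prod>i<n. Q (z i) (if i = 0 then s0 else z (i - 1)))"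

definition loglik_mean :: "nat \<Rightarrow> (nat \<Rightarrow> nat \<Rightarrow> real) \<Rightarrow> nat \<Rightarrow> nat \<Rightarrow> real" where
  "loglik_mean d Q s0 n =
     (\<Sum>z\<in>words d n. markov_prob Q s0 n z * (- ln (markov_prob Q s0 n z)))"

definition loglik_var :: "nat \<Rightarrow> (nat \<Rightarrow> nat \<Rightarrow> real) \<Rightarrow> nat \<Rightarrow> nat \<Rightarrow> real" where
  "loglik_var d Q s0 n =
     (\<Sum>z\<in>words d n. markov_prob Q s0 n z *
        (- ln (markov_prob Q s0 n z) - loglik_mean d Q s0 n)\<^sup>2)"

definition asym_var :: "nat \<Rightarrow> (nat \<Rightarrow> nat \<Rightarrow> real) \<Rightarrow> nat \<Rightarrow> real" where
  "asym_var d Q s0 = lim (\<lambda>n. loglik_var d Q s0 n / real n)"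

definition sub_mod :: "nat \<Rightarrow> nat \<Rightarrow> (nat \<Rightarrow> nat) \<Rightarrow> (nat \<Rightarrow> nat) \<Rightarrow> (nat \<Rightarrow> nat)" where
  "sub_mod d n y x = (\<lambda>i. if i < n then (y i + d - x i) mod d else undefined)"

definition chan_AM :: "nat \<Rightarrow> (nat \<Rightarrow> nat \<Rightarrow> real) \<Rightarrow> nat \<Rightarrow> nat \<Rightarrow> (nat \<Rightarrow> nat) \<Rightarrow> (nat \<Rightarrow> nat) \<Rightarrow> real" where
  "chan_AM d Q s0 n y x = markov_prob Q s0 n (sub_mod d n y x)"

definition is_code :: "nat \<Rightarrow> nat \<Rightarrow> nat \<Rightarrow> (nat \<Rightarrow> nat \<Rightarrow> nat) \<Rightarrow> (nat \<Rightarrow> (nat \<Rightarrow> nat) set) \<Rightarrow> bool" where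
  "is_code d n N \<phi> D \<longleftrightarrow> N \<ge> 1 \<and>
     (\<forall>i\<in>{1..N}. \<phi> i \<in> words d n \<and> D i \<subseteq> words d n) \<and>
     (\<forall>i\<in>{1..N}. \<forall>j\<in>{1..N}. i \<noteq> j \<longrightarrow> D i \<inter> D j = {})"

definition err_prob :: "nat \<Rightarrow> (nat \<Rightarrow> nat \<Rightarrow> real) \<Rightarrow> nat \<Rightarrow> nat \<Rightarrow> nat \<Rightarrow> (nat \<Rightarrow> nat \<Rightarrow> nat) \<Rightarrow> (nat \<Rightarrow> (nat \<Rightarrow> nat) set) \<Rightarrow> real" where
  "err_prob d Q s0 n N \<phi> D =
     (1 / real N) * (\<Sum>i=1..N. 1 - (\<Sum>y\<in>D i. chan_AM d Q s0 n y (\<phi> i)))"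

definition code_seq :: "nat \<Rightarrow> (nat \<Rightarrow> nat) \<Rightarrow> (nat \<Rightarrow> nat \<Rightarrow> nat \<Rightarrow> nat) \<Rightarrow> (nat \<Rightarrow> nat \<Rightarrow> (nat \<Rightarrow> nat) set) \<Rightarrow> bool" where
  "code_seq d N \<phi> D \<longleftrightarrow> (\<forall>n. is_code d n (N n) (\<phi> n) (D n))"

definition second_rate :: "nat \<Rightarrow> (nat \<Rightarrow> nat \<Rightarrow> real) \<Rightarrow> (nat \<Rightarrow> nat) \<Rightarrow> nat \<Rightarrow> real" where
  "second_rate d Q N n = (ln (real (N n)) - real n * cap_AM d Q) / sqrt (real n)"

definition CpAM :: "nat \<Rightarrow> (nat \<Rightarrow> nat \<Rightarrow> real) \<Rightarrow> nat \<Rightarrow> real \<Rightarrow> ereal" where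
  "CpAM d Q s0 a = Inf {limsup (\<lambda>n. ereal (err_prob d Q s0 n (N n) (\<phi> n) (D n))) | N \<phi> D.
      code_seq d N \<phi> D \<and> liminf (\<lambda>n. ereal (second_rate d Q N n)) \<ge> ereal a}"

definition CAM :: "nat \<Rightarrow> (nat \<Rightarrow> nat \<Rightarrow> real) \<Rightarrow> nat \<Rightarrow> real \<Rightarrow> ereal" where
  "CAM d Q s0 \<epsilon> = Sup {liminf (\<lambda>n. ereal (second_rate d Q N n)) | N \<phi> D.
      code_seq d N \<phi> D \<and> limsup (\<lambda>n. ereal (err_prob d Q s0 n (N n) (\<phi> n) (D n))) \<le> ereal \<epsilon>}"

definition Gauss_cdf :: "real \<Rightarrow> real" where
  "Gauss_cdf x = cdf (density lborel std_normal_density) x"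

definition Gauss_cdf_inv :: "real \<Rightarrow> real" where
  "Gauss_cdf_inv e = (THE x. Gauss_cdf x = e)"

end

theory Submission
  imports Defs "Jordan_Normal_Form.Determinant" "HOL-Real_Asymp.Real_Asymp"
begin

text \<open>The channel is additive, so coding is governed by the single random variable \<open>- ln Q\<^sup>n(Z)\<close>: the
  information-spectrum converse and Feinstein's lemma show that \<open>N\<close> codewords have optimal error
  \<open>Pr {Q\<^sup>n(Z) \<le> \<gamma>}\<close> with \<open>\<gamma>\<close> equal to \<open>N / d\<^sup>n\<close> up to a polynomial factor. It remains to prove the
  central limit theorem for the centred surprisal \<open>S\<close> of an irreducible, possibly periodic, chain.
  Two Poisson equations give functions \<open>g\<close>, \<open>h\<close> such that \<open>1 + i \<theta> g - \<theta>\<^sup>2 h / 2\<close> is, up to \<open>O(\<theta>\<^sup>3)\<close>, an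
  eigenfunction of the transition operator tilted by \<open>exp (i \<theta> S)\<close> with eigenvalue \<open>1 - V \<theta>\<^sup>2 / 2\<close>;
  iterating \<open>n\<close> times with \<open>\<theta>\<close> of order \<open>1 / sqrt n\<close> yields the Gaussian characteristic function.
  The same two functions show that the variance of \<open>S\<close> grows like \<open>V n\<close>, so \<open>V\<close> is \<open>asym_var\<close>.\<close>

section \<open>Stationary distribution and Poisson equation\<close>

lemma mult_mat_vec_sum:
  fixes A :: "nat \<Rightarrow> nat \<Rightarrow> real"
  assumes "i < d"
  shows "(mat d d (\<lambda>(i,j). A i j) *\<^sub>v vec d v) $ i = (\<Sum>j<d. A i j * v j)"
  using assms by (simp add: scalar_prod_def lessThan_atLeast0)

lemma square_system_det_zero_iff:
  fixes A :: "nat \<Rightarrow> nat \<Rightarrow> real"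
  shows "det (mat d d (\<lambda>(i,j). A i j)) = 0 \<longleftrightarrow>
    (\<exists>v. (\<forall>i<d. (\<Sum>j<d. A i j * v j) = 0) \<and> (\<exists>j<d. v j \<noteq> 0))"
proof -
  let ?M = "mat d d (\<lambda>(i,j). A i j)"
  have "det ?M = 0 \<longleftrightarrow> (\<exists>v. v \<in> carrier_vec d \<and> v \<noteq> 0\<^sub>v d \<and> ?M *\<^sub>v v = 0\<^sub>v d)"
    by (rule det_0_iff_vec_prod_zero_field) simp
  also have "\<dots> \<longleftrightarrow> (\<exists>v. (\<forall>i<d. (\<Sum>j<d. A i j * v j) = 0) \<and> (\<exists>j<d. v j \<noteq> 0))"
  proof safe
    fix v assume v: "v \<in> carrier_vec d" "v \<noteq> 0\<^sub>v d" "?M *\<^sub>v v = 0\<^sub>v d"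
    have vv: "vec d (\<lambda>i. v $ i) = v" using v(1) by auto
    have "\<forall>i<d. (\<Sum>j<d. A i j * v $ j) = 0"
      using v(3) mult_mat_vec_sum[of _ d A "\<lambda>i. v $ i"] unfolding vv by auto
    moreover have "\<exists>j<d. v $ j \<noteq> 0" using v(1,2) by (metis carrier_vecD eq_vecI index_zero_vec)
    ultimately show "\<exists>v. (\<forall>i<d. (\<Sum>j<d. A i j * v j) = 0) \<and> (\<exists>j<d. v j \<noteq> 0)" by blast
  next
    fix v j assume v: "\<forall>i<d. (\<Sum>j<d. A i j * v j) = 0" "j < d" "v j \<noteq> 0"
    have "?M *\<^sub>v vec d v = 0\<^sub>v d"
      using v(1) mult_mat_vec_sum[of _ d A v] by (intro eq_vecI) auto
    moreover have "vec d v \<noteq> 0\<^sub>v d" using v(2,3) by (metis index_vec index_zero_vec(1))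
    ultimately show "\<exists>v. v \<in> carrier_vec d \<and> v \<noteq> 0\<^sub>v d \<and> ?M *\<^sub>v v = 0\<^sub>v d" by (intro exI[of _ "vec d v"]) auto
  qed
  finally show ?thesis .
qed

text \<open>Injectivity gives a nonzero determinant, hence a right inverse \<open>B\<close>;
  applying \<open>B\<close> to the right-hand side yields a solution.\<close>

lemma square_system_solvable:
  fixes A :: "nat \<Rightarrow> nat \<Rightarrow> real"
  assumes "\<And>v. \<forall>i<d. (\<Sum>j<d. A i j * v j) = 0 \<Longrightarrow> \<forall>j<d. v j = 0"
  shows "\<exists>v. \<forall>i<d. (\<Sum>j<d. A i j * v j) = b i"
proof -
  let ?M = "mat d d (\<lambda>(i,j). A i j)"
  have "det ?M \<noteq> 0" unfolding square_system_det_zero_iff using assms by blast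
  then obtain B where B: "B \<in> carrier_mat d d" "?M * B = 1\<^sub>m d"
    using det_non_zero_imp_unit[of ?M d] unfolding Units_def ring_mat_def by auto
  define w where "w = B *\<^sub>v vec d b"
  have wc: "w \<in> carrier_vec d" using B by (auto simp: w_def)
  have "?M *\<^sub>v w = vec d b" unfolding w_def
    using B by (subst assoc_mult_mat_vec[symmetric, of _ d d _ d]) auto
  moreover have "vec d (\<lambda>i. w $ i) = w" using wc by auto
  ultimately show ?thesis
    using mult_mat_vec_sum[of _ d A "\<lambda>i. w $ i"] by (intro exI[of _ "\<lambda>i. w $ i"]) auto
qed

text \<open>A matrix and its transpose have the same determinant. This is what turns the constant
  vector, a kernel vector of I - Q^T, into a fixed vector of Q.\<close>

lemma square_system_left_kernel:
  fixes A :: "nat \<Rightarrow> nat \<Rightarrow> real"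
  assumes "\<forall>i<d. (\<Sum>j<d. A i j * v j) = 0" "k < d" "v k \<noteq> 0"
  shows "\<exists>w. (\<forall>j<d. (\<Sum>i<d. A i j * w i) = 0) \<and> (\<exists>i<d. w i \<noteq> 0)"
proof -
  have "det (mat d d (\<lambda>(i,j). A i j)) = 0" using assms square_system_det_zero_iff by blast
  moreover have "transpose_mat (mat d d (\<lambda>(i,j). A i j)) = mat d d (\<lambda>(i,j). A j i)" by (intro eq_matI) auto
  ultimately have "det (mat d d (\<lambda>(i,j). A j i)) = 0"
    using det_transpose[of "mat d d (\<lambda>(i,j). A i j)" d] by simp
  then show ?thesis using square_system_det_zero_iff[of d "\<lambda>i j. A j i"] by blast
qed

section \<open>Irreducible stochastic matrices: harmonic functions, stationary laws, Poisson
  equation\<close>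

locale irreducible_chain =
  fixes d :: nat and Q :: "nat \<Rightarrow> nat \<Rightarrow> real"
  assumes d_pos: "d \<ge> 1" and irred: "irreducible_tm d Q"
begin

lemma Q_nonneg: "x < d \<Longrightarrow> y < d \<Longrightarrow> Q y x \<ge> 0"
  and Q_sum: "x < d \<Longrightarrow> (\<Sum>y<d. Q y x) = 1"
  using irred by (auto simp: irreducible_tm_def stoch_matrix_def)

lemma mat_pow_nonneg: "x < d \<Longrightarrow> y < d \<Longrightarrow> mat_pow d Q k y x \<ge> 0"
  by (induction k arbitrary: y) (auto intro!: sum_nonneg mult_nonneg_nonneg Q_nonneg)

lemma mat_pow_sum: "x < d \<Longrightarrow> (\<Sum>y<d. mat_pow d Q k y x) = 1"
proof (induction k)
  case (Suc k)
  have "(\<Sum>y<d. mat_pow d Q (Suc k) y x) = (\<Sum>z<d. (\<Sum>y<d. Q y z) * mat_pow d Q k z x)"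
    by (simp add: sum_distrib_right, subst sum.swap, simp)
  then show ?case using Suc Q_sum by simp
qed simp

lemma harmonic_mat_pow:
  assumes g: "\<And>x. x < d \<Longrightarrow> (\<Sum>y<d. Q y x * g y) = g x" and x: "x < d"
  shows "(\<Sum>y<d. mat_pow d Q k y x * g y) = g x"
proof (induction k)
  case 0
  have "(\<Sum>y<d. mat_pow d Q 0 y x * g y) = (\<Sum>y<d. if y = x then g y else 0)"
    by (intro sum.cong) auto
  then show ?case using x by simp
next
  case (Suc k)
  have "(\<Sum>y<d. mat_pow d Q (Suc k) y x * g y) = (\<Sum>y<d. \<Sum>z<d. mat_pow d Q k z x * (Q y z * g y))"
    by (simp add: sum_distrib_right sum_distrib_left mult_ac)
  also have "\<dots> = (\<Sum>z<d. mat_pow d Q k z x * (\<Sum>y<d. Q y z * g y))"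
    by (subst sum.swap) (simp add: sum_distrib_left)
  also have "\<dots> = g x" using Suc g by simp
  finally show ?case .
qed

text \<open>Maximum principle. At a maximiser \<open>m\<close>, the nonnegative function
  \<open>M - g\<close> has mean zero under every power of the chain. Irreducibility supplies, for
  each \<open>y\<close>, some power that charges \<open>y\<close>, so \<open>g y = M\<close>. The
  power may depend on \<open>y\<close>, so periodic chains are covered.\<close>

lemma harmonic_const:
  assumes g: "\<And>x. x < d \<Longrightarrow> (\<Sum>y<d. Q y x * g y) = g x" and xy: "x < d" "y < d"
  shows "g x = (g y :: real)"
proof -
  define M where "M = Max (g ` {..<d})"
  have "M \<in> g ` {..<d}" unfolding M_def using xy by (intro Max_in) auto
  then obtain m where m: "m < d" "g m = M" by auto
  have le: "g y \<le> M" if "y < d" for y using that unfolding M_def by auto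
  have eq: "g y = M" if "y < d" for y
  proof -
    have "\<exists>k>0. mat_pow d Q k y m > 0" using irred m(1) that by (simp add: irreducible_tm_def)
    then obtain k where k: "mat_pow d Q k y m > 0" by blast
    have "(\<Sum>y<d. mat_pow d Q k y m * (M - g y)) = 0"
      using harmonic_mat_pow[OF g m(1), of k] mat_pow_sum[OF m(1), of k] m(2)
      by (simp add: right_diff_distrib sum_subtractf flip: sum_distrib_right)
    then have "mat_pow d Q k y m * (M - g y) = 0"
      using that le by (subst (asm) sum_nonneg_eq_0_iff)
        (auto intro!: mult_nonneg_nonneg mat_pow_nonneg m simp: le)
    then show ?thesis using k by auto
  qed
  show ?thesis using eq xy by simp
qed

text \<open>The all-ones vector is in the kernel of \<open>I - Q\<^sup>T\<close>, so \<open>I - Q\<close> is singular; taking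
  absolute values of a kernel vector preserves its total mass and hence the fixed-point equation.\<close>

lemma stationary_exists: "\<exists>P. stationary d Q P \<and> (\<forall>x\<ge>d. P x = 0)"
proof -
  define A where "A i j = (if i = j then 1 else 0) - Q j i" for i j
  have "(\<Sum>j<d. A i j * 1) = 0" if "i < d" for i
    using that Q_sum by (simp add: A_def sum_subtractf)
  then obtain w k where w: "\<And>j. j < d \<Longrightarrow> (\<Sum>i<d. A i j * w i) = 0" and k: "k < d" "w k \<noteq> 0"
    using square_system_left_kernel[of d A "\<lambda>_. 1" 0] d_pos by auto
  have fx: "(\<Sum>x<d. Q y x * w x) = w y" if "y < d" for y
  proof -
    have "(\<Sum>i<d. A i y * w i) = (\<Sum>i<d. (if i = y then w i else 0)) - (\<Sum>x<d. Q y x * w x)"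
      unfolding sum_subtractf[symmetric] A_def by (intro sum.cong) (auto simp: algebra_simps)
    then show ?thesis using w[OF that] that by simp
  qed
  have le: "\<bar>w y\<bar> \<le> (\<Sum>x<d. Q y x * \<bar>w x\<bar>)" if "y < d" for y
  proof -
    have "\<bar>w y\<bar> \<le> (\<Sum>x<d. \<bar>Q y x * w x\<bar>)" unfolding fx[OF that, symmetric] by (rule sum_abs)
    also have "\<dots> = (\<Sum>x<d. Q y x * \<bar>w x\<bar>)" using that Q_nonneg by (intro sum.cong) (auto simp: abs_mult)
    finally show ?thesis .
  qed
  have "(\<Sum>y<d. \<Sum>x<d. Q y x * \<bar>w x\<bar>) = (\<Sum>x<d. (\<Sum>y<d. Q y x) * \<bar>w x\<bar>)"
    by (subst sum.swap) (simp add: sum_distrib_right)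
  also have "\<dots> = (\<Sum>x<d. \<bar>w x\<bar>)" using Q_sum by simp
  finally have "(\<Sum>y<d. (\<Sum>x<d. Q y x * \<bar>w x\<bar>) - \<bar>w y\<bar>) = 0" by (simp add: sum_subtractf)
  then have eq: "(\<Sum>x<d. Q y x * \<bar>w x\<bar>) = \<bar>w y\<bar>" if "y < d" for y
    using that le by (subst (asm) sum_nonneg_eq_0_iff) auto
  define s where "s = (\<Sum>x<d. \<bar>w x\<bar>)"
  have "s > 0" unfolding s_def using k by (intro sum_pos2[of _ k]) auto
  define P where "P x = (if x < d then \<bar>w x\<bar> / s else 0)" for x
  have "(\<Sum>x<d. P x) = s / s" by (simp add: P_def s_def flip: sum_divide_distrib)
  moreover have "(\<Sum>x<d. Q y x * P x) = P y" if "y < d" for y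
    using eq[OF that] that by (simp add: P_def flip: sum_divide_distrib)
  ultimately have "stationary d Q P" using \<open>s > 0\<close> by (auto simp: stationary_def P_def)
  then show ?thesis by (intro exI[of _ P]) (auto simp: P_def)
qed

lemma stationary_sum_step:
  assumes "stationary d Q P"
  shows "(\<Sum>x<d. P x * (\<Sum>y<d. Q y x * g y)) = (\<Sum>y<d. P y * g y)"
proof -
  have "(\<Sum>x<d. P x * (\<Sum>y<d. Q y x * g y)) = (\<Sum>y<d. (\<Sum>x<d. Q y x * P x) * g y)"
    by (simp add: sum_distrib_left sum_distrib_right, subst sum.swap, simp add: mult_ac)
  also have "\<dots> = (\<Sum>y<d. P y * g y)" using assms by (simp add: stationary_def)
  finally show ?thesis .
qed

text \<open>Adding the rank-one term \<open>P \<cdot> g\<close> makes \<open>I - Q\<^sup>T\<close> injective, hence bijective.\<close>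

lemma poisson_equation_stationary:
  assumes P: "stationary d Q P"
  shows "\<exists>g. \<forall>x<d. g x - (\<Sum>y<d. Q y x * g y) = f x - (\<Sum>z<d. P z * f z)"
proof -
  define A where "A x y = (if x = y then 1 else 0) - Q y x + P y" for x y
  have A: "(\<Sum>y<d. A x y * g y) = g x - (\<Sum>y<d. Q y x * g y) + (\<Sum>y<d. P y * g y)" if "x < d" for x g
  proof -
    have "(\<Sum>y<d. A x y * g y) = (\<Sum>y<d. if x = y then g y else 0) - (\<Sum>y<d. Q y x * g y) + (\<Sum>y<d. P y * g y)"
      unfolding sum_subtractf[symmetric] sum.distrib[symmetric] A_def
      by (intro sum.cong) (auto simp: algebra_simps)
    then show ?thesis using that by simp
  qed
  have P1: "(\<Sum>x<d. P x) = 1" using P by (simp add: stationary_def)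
  \<comment> \<open>Averaging the system against \<open>P\<close> cancels the part coming from I -
    Q^T and leaves only the rank-one term, so every solution has the same \<open>P\<close>-mean as
    the right-hand side.\<close>
  have Pg: "(\<Sum>y<d. P y * g y) = (\<Sum>x<d. P x * b x)"
    if "\<And>x. x < d \<Longrightarrow> (\<Sum>y<d. A x y * g y) = b x" for g b
  proof -
    have "(\<Sum>x<d. P x * b x) = (\<Sum>x<d. P x * (g x - (\<Sum>y<d. Q y x * g y) + (\<Sum>y<d. P y * g y)))"
      using that A by (intro sum.cong) auto
    also have "\<dots> = (\<Sum>y<d. P y * g y)"
      using stationary_sum_step[OF P, of g] P1
      by (simp add: algebra_simps sum.distrib sum_subtractf flip: sum_distrib_left sum_distrib_right)
    finally show ?thesis by simp
  qed
  \<comment> \<open>A kernel vector has mean zero, so it is harmonic, hence constant; a constant of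
    mean zero is zero.\<close>
  have "\<forall>j<d. v j = 0" if v: "\<forall>i<d. (\<Sum>j<d. A i j * v j) = 0" for v
  proof -
    have 0: "(\<Sum>y<d. P y * v y) = 0" using Pg[of v "\<lambda>_. 0"] v by simp
    have "(\<Sum>y<d. Q y x * v y) = v x" if "x < d" for x using A[OF that, of v] v that 0 by simp
    then have c: "v x = v y" if "x < d" "y < d" for x y using harmonic_const that by blast
    have "v j = 0" if "j < d" for j
    proof -
      have "(\<Sum>y<d. P y * v y) = (\<Sum>y<d. P y * v j)" by (intro sum.cong refl) (metis c that lessThan_iff)
      also have "\<dots> = (\<Sum>y<d. P y) * v j" by (simp only: sum_distrib_right)
      finally show ?thesis using 0 P1 by simp
    qed
    then show ?thesis by blast
  qed
  then obtain g where g: "\<And>x. x < d \<Longrightarrow> (\<Sum>y<d. A x y * g y) = f x - (\<Sum>z<d. P z * f z)"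
    using square_system_solvable[of d A "\<lambda>x. f x - (\<Sum>z<d. P z * f z)"] by metis
  \<comment> \<open>The right-hand side is centred, so the rank-one term vanishes at the solution
    and the genuine Poisson equation remains.\<close>
  have "(\<Sum>y<d. P y * g y) = (\<Sum>x<d. P x * (f x - (\<Sum>z<d. P z * f z)))" by (rule Pg) (rule g)
  also have "\<dots> = 0" using P1 by (simp add: algebra_simps sum_subtractf flip: sum_distrib_left sum_distrib_right)
  finally show ?thesis using g A by (intro exI[of _ g]) auto
qed

text \<open>Take the Poisson equation for \<open>P\<close> with the indicator of \<open>z\<close> as
  datum and average it against \<open>P'\<close>: the left side vanishes and the right side is
  \<open>P' z - P z\<close>.\<close>

lemma stationary_unique:
  assumes "stationary d Q P" "stationary d Q P'" "z < d"
  shows "P z = P' z"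
proof -
  define f where "f x = (if x = z then 1 else 0 :: real)" for x
  obtain g where g: "\<And>x. x < d \<Longrightarrow> g x - (\<Sum>y<d. Q y x * g y) = f x - (\<Sum>z<d. P z * f z)"
    using poisson_equation_stationary[OF assms(1), of f] by blast
  have "0 = (\<Sum>x<d. P' x * (g x - (\<Sum>y<d. Q y x * g y)))"
    using stationary_sum_step[OF assms(2), of g] by (simp add: right_diff_distrib sum_subtractf)
  also have "\<dots> = (\<Sum>x<d. P' x * (f x - (\<Sum>z<d. P z * f z)))" using g by simp
  also have "\<dots> = (\<Sum>x<d. P' x * f x) - (\<Sum>z<d. P z * f z)"
    using assms(2) by (simp add: right_diff_distrib sum_subtractf stationary_def flip: sum_distrib_right)
  finally show ?thesis using assms(3) by (simp add: f_def if_distrib cong: if_cong)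
qed

lemma stat_dist_stationary: "stationary d Q (stat_dist d Q)"
proof -
  obtain P where P: "stationary d Q P \<and> (\<forall>x. x \<ge> d \<longrightarrow> P x = 0)" using stationary_exists by blast
  have "stationary d Q (stat_dist d Q) \<and> (\<forall>x. x \<ge> d \<longrightarrow> stat_dist d Q x = 0)"
    unfolding stat_dist_def
  proof (rule theI[where a = P])
    show "stationary d Q P \<and> (\<forall>x. x \<ge> d \<longrightarrow> P x = 0)" by (rule P)
  next
    fix P' assume "stationary d Q P' \<and> (\<forall>x. x \<ge> d \<longrightarrow> P' x = 0)"
    \<comment> \<open>Vanishing from \<open>d\<close> on upgrades agreement below \<open>d\<close>
      to equality of functions, as the definite description requires.\<close>
    then show "P' = P" using P stationary_unique[of P' P] by (metis ext not_le)
  qed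
  then show ?thesis ..
qed

lemmas poisson_equation = poisson_equation_stationary[OF stat_dist_stationary]

end

section \<open>Words of the Markov source and the asymptotic variance\<close>

lemma finite_words [simp]: "finite (words d n)"
  unfolding words_def by (intro finite_PiE) auto

lemma card_words: "card (words d n) = d ^ n"
  unfolding words_def by (simp add: card_funcsetE)

lemma words_less: "z \<in> words d n \<Longrightarrow> i < n \<Longrightarrow> z i < d"
  unfolding words_def by (auto dest: PiE_mem)

lemma sum_words_0: "(\<Sum>z\<in>words d 0. F z) = F (\<lambda>_. undefined)"
  unfolding words_def by simp

text \<open>A word of length n+1 arises from a unique word of length n by writing one letter at
  position n. All later inductions on the block length rest on this recursion.\<close>

lemma sum_words_Suc: "(\<Sum>z\<in>words d (Suc n). F z) = (\<Sum>z\<in>words d n. \<Sum>y<d. F (z(n := y)))"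
proof -
  have eq: "words d (Suc n) = (\<lambda>(y, g). g(n := y)) ` ({0..<d} \<times> words d n)"
    unfolding words_def atLeast0_lessThan_Suc by (rule PiE_insert_eq)
  have inj: "inj_on (\<lambda>(y, g). g(n := y)) ({0..<d} \<times> words d n)"
    unfolding words_def by (rule inj_combinator) simp
  have "(\<Sum>z\<in>words d (Suc n). F z) = (\<Sum>(y, z)\<in>{0..<d} \<times> words d n. F (z(n := y)))"
    unfolding eq by (subst sum.reindex[OF inj]) (simp add: case_prod_unfold)
  also have "\<dots> = (\<Sum>y\<in>{0..<d}. \<Sum>z\<in>words d n. F (z(n := y)))"
    by (simp add: sum.cartesian_product)
  also have "\<dots> = (\<Sum>z\<in>words d n. \<Sum>y<d. F (z(n := y)))"
    by (subst sum.swap) (simp add: atLeast0LessThan)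
  finally show ?thesis .
qed

text \<open>Treating \<open>s0\<close> as the state before the first letter spares the recursions a
  case distinction at time zero.\<close>

definition last_state :: "nat \<Rightarrow> nat \<Rightarrow> (nat \<Rightarrow> nat) \<Rightarrow> nat" where
  "last_state s0 n z = (if n = 0 then s0 else z (n - 1))"

text \<open>Written as a sum of one-step terms in order to be additive along every word. It agrees
  with the negative log-likelihood on words of nonzero probability (\<open>ln_markov_prob\<close>),
  and the others carry no weight.\<close>

definition surprisal :: "(nat \<Rightarrow> nat \<Rightarrow> real) \<Rightarrow> nat \<Rightarrow> nat \<Rightarrow> (nat \<Rightarrow> nat) \<Rightarrow> real" where
  "surprisal Q s0 n z = (\<Sum>i<n. - ln (Q (z i) (last_state s0 i z)))"

lemma last_state_Suc [simp]: "last_state s0 (Suc n) (z(n := y)) = y"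
  by (simp add: last_state_def)

lemma last_state_upd: "i \<le> n \<Longrightarrow> last_state s0 i (z(n := y)) = last_state s0 i z"
  by (auto simp: last_state_def)

lemma markov_prob_eq: "markov_prob Q s0 n z = (\<Prod>i<n. Q (z i) (last_state s0 i z))"
  by (simp add: markov_prob_def last_state_def)

lemma markov_prob_Suc:
  "markov_prob Q s0 (Suc n) (z(n := y)) = markov_prob Q s0 n z * Q y (last_state s0 n z)"
proof -
  have "(\<Prod>i<n. Q ((z(n := y)) i) (last_state s0 i (z(n := y)))) = (\<Prod>i<n. Q (z i) (last_state s0 i z))"
    by (intro prod.cong) (auto simp: last_state_upd)
  then show ?thesis by (simp add: markov_prob_eq last_state_upd)
qed

lemma surprisal_Suc:
  "surprisal Q s0 (Suc n) (z(n := y)) = surprisal Q s0 n z - ln (Q y (last_state s0 n z))"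
proof -
  have "(\<Sum>i<n. - ln (Q ((z(n := y)) i) (last_state s0 i (z(n := y))))) = (\<Sum>i<n. - ln (Q (z i) (last_state s0 i z)))"
    by (intro sum.cong) (auto simp: last_state_upd)
  then show ?thesis by (simp add: surprisal_def last_state_upd)
qed

lemma surprisal_0 [simp]: "surprisal Q s0 0 z = 0"
  by (simp add: surprisal_def)

lemma bounded_on_lessThan: "\<exists>B\<ge>0. \<forall>x<(d::nat). \<bar>F x :: real\<bar> \<le> B"
  by (intro exI[of _ "\<Sum>x<d. \<bar>F x\<bar>"]) (auto intro!: sum_nonneg member_le_sum)

locale markov_source = irreducible_chain +
  fixes s0 :: nat
  assumes s0: "s0 < d"
begin

text \<open>Expectation over the first \<open>n\<close> noise letters. Values in an arbitrary normed
  space let the same rules serve real moments and complex characteristic functions.\<close>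

definition wexp :: "nat \<Rightarrow> ((nat \<Rightarrow> nat) \<Rightarrow> 'a::real_normed_vector) \<Rightarrow> 'a" where
  "wexp n F = (\<Sum>z\<in>words d n. markov_prob Q s0 n z *\<^sub>R F z)"

lemma last_state_less: "z \<in> words d n \<Longrightarrow> last_state s0 n z < d"
  using s0 by (auto simp: last_state_def words_less)

lemma last_state_less': "z \<in> words d n \<Longrightarrow> i \<le> n \<Longrightarrow> last_state s0 i z < d"
  using s0 by (auto simp: last_state_def words_less)

lemma markov_prob_nonneg: "z \<in> words d n \<Longrightarrow> markov_prob Q s0 n z \<ge> 0"
  unfolding markov_prob_eq
  by (intro prod_nonneg) (auto intro!: Q_nonneg simp: words_less last_state_less')

lemma ln_markov_prob:
  assumes z: "z \<in> words d n" and "markov_prob Q s0 n z \<noteq> 0"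
  shows "- ln (markov_prob Q s0 n z) = surprisal Q s0 n z"
proof -
  have "Q (z i) (last_state s0 i z) > 0" if "i < n" for i
  proof -
    have "Q (z i) (last_state s0 i z) \<noteq> 0" using assms(2) that by (auto simp: markov_prob_eq)
    moreover have "Q (z i) (last_state s0 i z) \<ge> 0"
      using that z by (intro Q_nonneg) (auto simp: words_less last_state_less')
    ultimately show ?thesis by simp
  qed
  then show ?thesis unfolding markov_prob_eq surprisal_def
    by (subst ln_prod) (auto simp: sum_negf less_imp_neq[symmetric])
qed

lemma wexp_0: "wexp 0 F = F (\<lambda>_. undefined)"
  by (simp add: wexp_def sum_words_0 markov_prob_def)

text \<open>The Markov property in tower form: the last letter is averaged first, given the
  preceding ones.\<close>

lemma wexp_Suc: "wexp (Suc n) F = wexp n (\<lambda>z. \<Sum>y<d. Q y (last_state s0 n z) *\<^sub>R F (z(n := y)))"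
  by (simp add: wexp_def sum_words_Suc markov_prob_Suc scaleR_sum_right)

lemma wexp_cong: "(\<And>z. z \<in> words d n \<Longrightarrow> F z = G z) \<Longrightarrow> wexp n F = wexp n G"
  by (simp add: wexp_def)

lemma wexp_add: "wexp n (\<lambda>z. F z + G z) = wexp n F + wexp n G"
  by (simp add: wexp_def sum.distrib scaleR_add_right)

lemma wexp_diff: "wexp n (\<lambda>z. F z - G z) = wexp n F - wexp n G"
  by (simp add: wexp_def sum_subtractf scaleR_diff_right)

lemma wexp_mult_left: "wexp n (\<lambda>z. (c::'a::real_normed_algebra) * F z) = c * wexp n F"
  by (simp add: wexp_def sum_distrib_left)

lemma wexp_const: "wexp n (\<lambda>_. c) = c"
proof (induction n)
  case (Suc n)
  have "wexp (Suc n) (\<lambda>_. c) = wexp n (\<lambda>z. c)"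
    unfolding wexp_Suc
    by (intro wexp_cong) (simp add: last_state_less Q_sum flip: scaleR_sum_left)
  then show ?case using Suc by simp
qed (simp add: wexp_0)

lemma wexp_mono: "(\<And>z. z \<in> words d n \<Longrightarrow> F z \<le> (G z :: real)) \<Longrightarrow> wexp n F \<le> wexp n G"
  by (auto simp: wexp_def intro!: sum_mono mult_left_mono markov_prob_nonneg)

lemma norm_wexp_le: "norm (wexp n F) \<le> wexp n (\<lambda>z. norm (F z))"
  unfolding wexp_def by (rule sum_norm_le) (simp add: markov_prob_nonneg)

lemma norm_wexp_bound:
  assumes "\<And>z. z \<in> words d n \<Longrightarrow> norm (F z) \<le> b" shows "norm (wexp n F) \<le> b"
proof -
  have "norm (wexp n F) \<le> wexp n (\<lambda>z. norm (F z))" by (rule norm_wexp_le)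
  also have "\<dots> \<le> wexp n (\<lambda>_. b)" by (rule wexp_mono) (rule assms)
  finally show ?thesis by (simp add: wexp_const)
qed

lemma wexp_real: "wexp n F = (\<Sum>z\<in>words d n. markov_prob Q s0 n z * (F z :: real))"
  by (simp add: wexp_def)

section \<open>Centred surprisal, its two correctors, and the growth of its variance\<close>

abbreviation H :: real where "H \<equiv> entropy_rate d Q"

abbreviation P :: "nat \<Rightarrow> real" where "P \<equiv> stat_dist d Q"

definition inc :: "nat \<Rightarrow> nat \<Rightarrow> real" where
  "inc y x = - ln (Q y x) - H"

definition S :: "nat \<Rightarrow> (nat \<Rightarrow> nat) \<Rightarrow> real" where
  "S n z = surprisal Q s0 n z - real n * H"

lemma S_0 [simp]: "S 0 z = 0" by (simp add: S_def)

lemma S_Suc: "S (Suc n) (z(n := y)) = S n z + inc y (last_state s0 n z)"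
  by (simp add: S_def surprisal_Suc inc_def algebra_simps)

text \<open>The solvability condition for the first corrector: \<open>H\<close> is exactly the
  stationary mean of the one-step surprisal.\<close>

lemma inc_mean: "(\<Sum>x<d. P x * (\<Sum>y<d. Q y x * inc y x)) = 0"
proof -
  have "(\<Sum>y<d. Q y x * inc y x) = (\<Sum>y<d. - Q y x * ln (Q y x)) - H" if "x < d" for x
  proof -
    have "(\<Sum>y<d. Q y x * inc y x) = (\<Sum>y<d. - Q y x * ln (Q y x)) - (\<Sum>y<d. Q y x) * H"
      unfolding sum_distrib_right sum_subtractf[symmetric]
      by (intro sum.cong) (auto simp: inc_def algebra_simps)
    then show ?thesis using Q_sum[OF that] by simp
  qed
  then have "(\<Sum>x<d. P x * (\<Sum>y<d. Q y x * inc y x)) = (\<Sum>x<d. P x * ((\<Sum>y<d. - Q y x * ln (Q y x)) - H))"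
    by (intro sum.cong) auto
  also have "\<dots> = H - (\<Sum>x<d. P x) * H"
    by (simp only: right_diff_distrib sum_subtractf sum_distrib_right entropy_rate_def)
  finally show ?thesis using stat_dist_stationary by (simp add: stationary_def)
qed

text \<open>\<open>g\<close> turns \<open>S\<close> into the martingale \<open>S n z + g (last_state s0 n z)\<close>; \<open>h\<close> does the same for its
  square, whose compensator grows at the constant rate \<open>V\<close>.\<close>

lemma ex_corrector1: "\<exists>g. \<forall>x<d. g x - (\<Sum>y<d. Q y x * g y) = (\<Sum>y<d. Q y x * inc y x)"
  using poisson_equation[of "\<lambda>x. (\<Sum>y<d. Q y x * inc y x)"] unfolding inc_mean by simp

definition g :: "nat \<Rightarrow> real" where
  "g = (SOME g. \<forall>x<d. g x - (\<Sum>y<d. Q y x * g y) = (\<Sum>y<d. Q y x * inc y x))"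

lemma g_eq: "x < d \<Longrightarrow> (\<Sum>y<d. Q y x * (inc y x + g y)) = g x"
  using someI_ex[OF ex_corrector1, folded g_def] by (force simp: distrib_left sum.distrib)

text \<open>The conditional one-step drift of \<open>S^2 + 2 S g\<close> from state
  \<open>x\<close>: when the squares are expanded, \<open>g_eq\<close> absorbs every term linear in
  \<open>S\<close>, and this remains.\<close>

definition c :: "nat \<Rightarrow> real" where
  "c x = (\<Sum>y<d. Q y x * ((inc y x)\<^sup>2 + 2 * inc y x * g y))"

text \<open>The stationary mean of the drift \<open>c\<close>; \<open>asym_var_eq\<close> identifies
  it with the asymptotic variance.\<close>

definition V :: real where "V = (\<Sum>x<d. P x * c x)"

lemma ex_corrector2: "\<exists>h. \<forall>x<d. h x - (\<Sum>y<d. Q y x * h y) = c x - V"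
  unfolding V_def by (rule poisson_equation)

definition h :: "nat \<Rightarrow> real" where
  "h = (SOME h. \<forall>x<d. h x - (\<Sum>y<d. Q y x * h y) = c x - V)"

lemma h_eq: "x < d \<Longrightarrow> (\<Sum>y<d. Q y x * ((inc y x)\<^sup>2 + 2 * inc y x * g y + h y)) = h x + V"
  using someI_ex[OF ex_corrector2, folded h_def] unfolding c_def
  by (force simp: distrib_left sum.distrib)

lemma mean_martingale: "wexp n (\<lambda>z. S n z + g (last_state s0 n z)) = g s0"
proof (induction n)
  case (Suc n)
  have "(\<Sum>y<d. Q y x * (a + inc y x + g y)) = a + g x" if "x < d" for x a
  proof -
    have "(\<Sum>y<d. Q y x * (a + inc y x + g y)) = (\<Sum>y<d. Q y x) * a + (\<Sum>y<d. Q y x * (inc y x + g y))"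
      by (simp add: algebra_simps sum.distrib sum_distrib_left)
    then show ?thesis using g_eq[OF that] Q_sum[OF that] by simp
  qed
  then have "wexp (Suc n) (\<lambda>z. S (Suc n) z + g (last_state s0 (Suc n) z)) =
      wexp n (\<lambda>z. S n z + g (last_state s0 n z))"
    unfolding wexp_Suc by (intro wexp_cong) (auto simp: S_Suc last_state_less)
  then show ?case using Suc by simp
qed (simp add: wexp_0 last_state_def)

lemma square_martingale:
  "wexp n (\<lambda>z. (S n z)\<^sup>2 + 2 * S n z * g (last_state s0 n z) + h (last_state s0 n z)) = h s0 + real n * V"
proof (induction n)
  case (Suc n)
  have "(\<Sum>y<d. Q y x * ((a + inc y x)\<^sup>2 + 2 * (a + inc y x) * g y + h y)) = (a\<^sup>2 + 2 * a * g x + h x) + V"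
    if "x < d" for x a
  proof -
    have "(\<Sum>y<d. Q y x * ((a + inc y x)\<^sup>2 + 2 * (a + inc y x) * g y + h y)) =
       (\<Sum>y<d. Q y x) * a\<^sup>2 + 2 * a * (\<Sum>y<d. Q y x * (inc y x + g y))
        + (\<Sum>y<d. Q y x * ((inc y x)\<^sup>2 + 2 * inc y x * g y + h y))"
      unfolding sum_distrib_left sum_distrib_right sum.distrib[symmetric]
      by (intro sum.cong) (auto simp: algebra_simps power2_eq_square)
    then show ?thesis using g_eq[OF that] h_eq[OF that] Q_sum[OF that] by simp
  qed
  then have "wexp (Suc n) (\<lambda>z. (S (Suc n) z)\<^sup>2 + 2 * S (Suc n) z * g (last_state s0 (Suc n) z) + h (last_state s0 (Suc n) z)) =
      wexp n (\<lambda>z. ((S n z)\<^sup>2 + 2 * S n z * g (last_state s0 n z) + h (last_state s0 n z)) + V)"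
    unfolding wexp_Suc by (intro wexp_cong) (auto simp: S_Suc last_state_less)
  then show ?case using Suc by (simp add: wexp_add wexp_const algebra_simps)
qed (simp add: wexp_0 last_state_def)

lemma loglik_mean_eq: "loglik_mean d Q s0 n = wexp n (S n) + real n * H"
proof -
  have "loglik_mean d Q s0 n = wexp n (surprisal Q s0 n)"
    unfolding loglik_mean_def wexp_real
    by (intro sum.cong refl) (metis ln_markov_prob mult_zero_left)
  also have "surprisal Q s0 n = (\<lambda>z. S n z + real n * H)" by (auto simp: S_def)
  finally show ?thesis by (simp add: wexp_add wexp_const)
qed

lemma loglik_var_eq: "loglik_var d Q s0 n = wexp n (\<lambda>z. (S n z)\<^sup>2) - (wexp n (S n))\<^sup>2"
proof -
  define m where "m = wexp n (S n)"
  have mean: "loglik_mean d Q s0 n = m + real n * H" by (simp add: loglik_mean_eq m_def)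
  have "loglik_var d Q s0 n = wexp n (\<lambda>z. (S n z - m)\<^sup>2)"
    unfolding loglik_var_def wexp_real mean
  proof (intro sum.cong refl)
    fix z assume z: "z \<in> words d n"
    show "markov_prob Q s0 n z * (- ln (markov_prob Q s0 n z) - (m + real n * H))\<^sup>2 =
          markov_prob Q s0 n z * (S n z - m)\<^sup>2"
    proof (cases "markov_prob Q s0 n z = 0")
      case False
      show ?thesis unfolding ln_markov_prob[OF z False] by (simp add: S_def algebra_simps)
    qed simp
  qed
  also have "(\<lambda>z. (S n z - m)\<^sup>2) = (\<lambda>z. (S n z)\<^sup>2 - 2 * m * S n z + m\<^sup>2)"
    by (auto simp: power2_eq_square algebra_simps)
  also have "wexp n \<dots> = wexp n (\<lambda>z. (S n z)\<^sup>2) - m\<^sup>2"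
    by (simp add: wexp_add wexp_diff wexp_const wexp_mult_left m_def[symmetric] power2_eq_square)
  finally show ?thesis by (simp add: m_def)
qed

text \<open>By \<open>square_martingale\<close> the second moment of \<open>S\<close> is
  \<open>n V\<close> up to a bounded term and a cross term 2 E[S g]. Young's inequality bounds the
  latter by \<eta> E[S^2] + G^2 / \<eta>. First \<eta> = 1/2 shows that the second moment is O(n);
  then \<eta> = 1 / sqrt n makes the cross term O(sqrt n). The mean of \<open>S\<close> stays
  bounded by \<open>mean_martingale\<close>.\<close>

lemma loglik_var_limit: "(\<lambda>n. loglik_var d Q s0 n / real n) \<longlonglongrightarrow> V"
proof -
  obtain G where G: "G \<ge> 0" "\<And>x. x < d \<Longrightarrow> \<bar>g x\<bar> \<le> G" using bounded_on_lessThan[of d g] by blast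
  obtain K where K: "K \<ge> 0" "\<And>x. x < d \<Longrightarrow> \<bar>h x\<bar> \<le> K" using bounded_on_lessThan[of d h] by blast
  define e where "e n = wexp n (\<lambda>z. (S n z)\<^sup>2)" for n
  have cross: "\<bar>wexp n (\<lambda>z. 2 * S n z * g (last_state s0 n z))\<bar> \<le> \<eta> * e n + G\<^sup>2 / \<eta>"
    if \<eta>: "\<eta> > 0" for n \<eta>
  proof -
    have "\<bar>2 * s * q\<bar> \<le> \<eta> * s\<^sup>2 + G\<^sup>2 / \<eta>" if q: "\<bar>q\<bar> \<le> G" for s q
    proof -
      have "\<bar>2 * s * q\<bar> = 2 * \<bar>s\<bar> * \<bar>q\<bar>" by (simp add: abs_mult)
      also have "\<dots> \<le> 2 * \<bar>s\<bar> * G" using q by (intro mult_left_mono) auto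
      \<comment> \<open>Young's inequality, multiplied by \<eta> so that the difference of the two
        sides is a perfect square.\<close>
      also have "\<eta> * (\<eta> * s\<^sup>2 + G\<^sup>2 / \<eta> - 2 * \<bar>s\<bar> * G) = (\<eta> * \<bar>s\<bar> - G)\<^sup>2"
        using \<eta> by (simp add: power2_eq_square field_simps)
      then have "\<eta> * (\<eta> * s\<^sup>2 + G\<^sup>2 / \<eta> - 2 * \<bar>s\<bar> * G) \<ge> 0" by simp
      then have "2 * \<bar>s\<bar> * G \<le> \<eta> * s\<^sup>2 + G\<^sup>2 / \<eta>" using \<eta> by (simp add: zero_le_mult_iff)
      finally show ?thesis .
    qed
    then have "wexp n (\<lambda>z. \<bar>2 * S n z * g (last_state s0 n z)\<bar>) \<le> wexp n (\<lambda>z. \<eta> * (S n z)\<^sup>2 + G\<^sup>2 / \<eta>)"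
      by (intro wexp_mono) (auto simp: G last_state_less)
    also have "\<dots> = \<eta> * e n + G\<^sup>2 / \<eta>" by (simp add: wexp_add wexp_mult_left wexp_const e_def)
    finally show ?thesis using norm_wexp_le[of n "\<lambda>z. 2 * S n z * g (last_state s0 n z)"] by simp
  qed
  have hb: "\<bar>wexp n (\<lambda>z. h (last_state s0 n z))\<bar> \<le> K" for n
    using norm_wexp_bound[of n "\<lambda>z. h (last_state s0 n z)" K] K last_state_less by auto
  have eb: "\<bar>e n - real n * V\<bar> \<le> \<eta> * e n + G\<^sup>2 / \<eta> + 2 * K" if \<eta>: "\<eta> > 0" for n \<eta>
  proof -
    have "e n + wexp n (\<lambda>z. 2 * S n z * g (last_state s0 n z)) + wexp n (\<lambda>z. h (last_state s0 n z)) = h s0 + real n * V"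
      using square_martingale[of n] by (simp add: wexp_add e_def)
    then show ?thesis using cross[OF \<eta>, of n] hb[of n] K(2)[OF s0] by linarith
  qed
  define B where "B = 4 * G\<^sup>2 + 4 * K + 2 * \<bar>V\<bar>"
  have "B \<ge> 0" using K by (simp add: B_def)
  have e_le: "e n \<le> B * real n" if "n \<ge> 1" for n
  proof -
    have "e n \<le> 2 * (real n * V) + 4 * G\<^sup>2 + 4 * K" using eb[of "1/2" n] by (simp add: abs_le_iff)
    also have "\<dots> \<le> 2 * (real n * \<bar>V\<bar>) + (4 * G\<^sup>2 + 4 * K) * real n"
    proof -
      have "4 * G\<^sup>2 + 4 * K \<le> (4 * G\<^sup>2 + 4 * K) * real n"
        using that K(1) mult_left_mono[of 1 "real n" "4 * G\<^sup>2 + 4 * K"] by simp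
      moreover have "real n * V \<le> real n * \<bar>V\<bar>" by (intro mult_left_mono) auto
      ultimately show ?thesis by linarith
    qed
    finally show ?thesis by (simp add: B_def algebra_simps)
  qed
  have m: "\<bar>wexp n (S n)\<bar> \<le> 2 * G" for n
  proof -
    have "\<bar>wexp n (\<lambda>z. g (last_state s0 n z))\<bar> \<le> G"
      using norm_wexp_bound[of n "\<lambda>z. g (last_state s0 n z)" G] G last_state_less by auto
    moreover have "wexp n (S n) + wexp n (\<lambda>z. g (last_state s0 n z)) = g s0"
      using mean_martingale[of n] by (simp add: wexp_add)
    ultimately show ?thesis using G(2)[OF s0] by linarith
  qed
  have main: "\<bar>loglik_var d Q s0 n / real n - V\<bar> \<le> (B + G\<^sup>2) / sqrt (real n) + (2 * K + 4 * G\<^sup>2) / real n"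
    if n: "n \<ge> 1" for n
  proof -
    have sq: "sqrt (real n) > 0" "sqrt (real n) * sqrt (real n) = real n" using n by auto
    have "\<bar>e n - real n * V\<bar> \<le> 1 / sqrt (real n) * e n + G\<^sup>2 * sqrt (real n) + 2 * K"
      using eb[of "1 / sqrt (real n)" n] n by simp
    also have "1 / sqrt (real n) * e n \<le> 1 / sqrt (real n) * (B * real n)"
      using e_le[OF n] by (intro mult_left_mono) auto
    also have "1 / sqrt (real n) * (B * real n) = B * sqrt (real n)"
      using sq by (simp add: field_simps)
    finally have 1: "\<bar>e n - real n * V\<bar> \<le> (B + G\<^sup>2) * sqrt (real n) + 2 * K" by (simp add: algebra_simps)
    have "(wexp n (S n))\<^sup>2 \<le> (2 * G)\<^sup>2" using m[of n] by (metis abs_ge_zero power2_abs power_mono)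
    then have 2: "\<bar>(wexp n (S n))\<^sup>2\<bar> \<le> 4 * G\<^sup>2" by (simp add: power_mult_distrib)
    have "\<bar>loglik_var d Q s0 n - real n * V\<bar> \<le> (B + G\<^sup>2) * sqrt (real n) + (2 * K + 4 * G\<^sup>2)"
      unfolding loglik_var_eq e_def[symmetric] using 1 2 by linarith
    then have "\<bar>loglik_var d Q s0 n - real n * V\<bar> / real n \<le> ((B + G\<^sup>2) * sqrt (real n) + (2 * K + 4 * G\<^sup>2)) / real n"
      using n by (intro divide_right_mono) auto
    moreover have "\<bar>loglik_var d Q s0 n - real n * V\<bar> / real n = \<bar>loglik_var d Q s0 n / real n - V\<bar>"
    proof -
      have "loglik_var d Q s0 n / real n - V = (loglik_var d Q s0 n - real n * V) / real n"
        using n by (simp add: field_simps)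
      then show ?thesis by simp
    qed
    moreover have "(B + G\<^sup>2) * sqrt (real n) / real n = (B + G\<^sup>2) / sqrt (real n)"
      using sq by (simp add: field_simps)
    ultimately show ?thesis by (simp add: add_divide_distrib)
  qed
  have "(\<lambda>n. (B + G\<^sup>2) / sqrt (real n) + (2 * K + 4 * G\<^sup>2) / real n) \<longlonglongrightarrow> 0"
    by real_asymp
  then have "(\<lambda>n. loglik_var d Q s0 n / real n - V) \<longlonglongrightarrow> 0"
    by (rule Lim_null_comparison[rotated]) (use main in \<open>auto intro!: eventually_sequentiallyI[of 1]\<close>)
  then show ?thesis by (simp add: LIM_zero_iff)
qed

lemma asym_var_eq: "asym_var d Q s0 = V"
  unfolding asym_var_def using loglik_var_limit by (rule limI)

end

section \<open>Central limit theorem\<close>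

lemma Gauss_cdf_eq: "Gauss_cdf = cdf std_normal_distribution"
  by (auto simp: Gauss_cdf_def)

interpretation std_normal: real_distribution std_normal_distribution
  by (rule real_dist_normal_dist)

lemma isCont_Gauss_cdf: "isCont Gauss_cdf x"
proof -
  have "emeasure std_normal_distribution {x} = (\<integral>\<^sup>+ y. std_normal_density y * indicator {x} y \<partial>lborel)"
    by (subst emeasure_density) auto
  also have "\<dots> = 0" by (subst nn_integral_0_iff_AE) (auto simp: AE_lborel_singleton indicator_eq_0_iff intro: AE_mp[OF AE_lborel_singleton[of x]])
  finally show ?thesis unfolding Gauss_cdf_eq std_normal.isCont_cdf by (simp add: measure_def)
qed

lemma Gauss_cdf_strict_mono: assumes "x < y" shows "Gauss_cdf x < Gauss_cdf y"
proof -
  have "emeasure std_normal_distribution {x<..y} \<noteq> 0"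
  proof
    assume "emeasure std_normal_distribution {x<..y} = 0"
    then have "(\<integral>\<^sup>+ z. ennreal (std_normal_density z) * indicator {x<..y} z \<partial>lborel) = 0"
      by (subst (asm) emeasure_density) auto
    then have "AE z in lborel. ennreal (std_normal_density z) * indicator {x<..y} z = 0"
      by (subst (asm) nn_integral_0_iff_AE) auto
    then have "AE z in lborel. z \<notin> {x<..y}"
      proof eventually_elim
      case (elim z)
      have "std_normal_density z > 0" by (rule normal_density_pos) simp
      then show ?case using elim by (auto simp: indicator_def ennreal_eq_0_iff split: if_splits)
    qed
    then have "emeasure lborel {x<..y} = 0"
      by (subst (asm) AE_iff_measurable[of "{x<..y}"]) auto
    then show False using assms by simp
  qed
  then have "measure std_normal_distribution {x<..y} \<noteq> 0"
    using std_normal.emeasure_eq_measure by simp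
  then show ?thesis
    using std_normal.cdf_diff_eq[OF assms] measure_nonneg[of std_normal_distribution "{x<..y}"]
    unfolding Gauss_cdf_eq by linarith
qed

text \<open>The limits at both ends and the intermediate value theorem give existence; strict
  monotonicity gives the uniqueness behind the definite description.\<close>

lemma Gauss_cdf_inv: assumes "0 < e" "e < 1" shows "Gauss_cdf (Gauss_cdf_inv e) = e"
proof -
  have "\<forall>\<^sub>F x in at_bot. Gauss_cdf x < e"
    using std_normal.cdf_lim_at_bot assms(1) unfolding Gauss_cdf_eq by (rule order_tendstoD(2))
  then obtain a where a: "Gauss_cdf a < e" by (auto simp: eventually_at_bot_linorder)
  have "\<forall>\<^sub>F x in at_top. Gauss_cdf x > e"
    using std_normal.cdf_lim_at_top_prob assms(2) unfolding Gauss_cdf_eq by (rule order_tendstoD(1))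
  then obtain b where b: "Gauss_cdf b > e" by (auto simp: eventually_at_top_linorder)
  have "a < b" using a b Gauss_cdf_strict_mono[of b a] by (cases a b rule: linorder_cases) auto
  then obtain x where "Gauss_cdf x = e"
    using IVT[of Gauss_cdf a e b] a b isCont_Gauss_cdf by auto
  then show ?thesis unfolding Gauss_cdf_inv_def
    using Gauss_cdf_strict_mono by (intro theI[of "\<lambda>x. Gauss_cdf x = e" x]) (metis less_irrefl linorder_cases)+
qed

text \<open>One summand of the tilted operator, expanded in \<theta>. The exponential is replaced by
  its Taylor polynomial \<open>p\<close> of degree 2. In the product of \<open>p\<close> with the
  corrected vector, the terms up to \<theta>^2 are exactly the subtracted number, whose imaginary
  and real parts carry the integrands of \<open>g_eq\<close> and \<open>h_eq\<close>. The bound on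
  \<theta> lets the \<theta>^4 term be absorbed into \<theta>^3.\<close>

lemma iexp_mult_corrector_bound:
  fixes a g h \<theta> :: real
  assumes "\<bar>\<theta>\<bar> \<le> 1"
  shows "norm (iexp (\<theta> * a) * Complex (1 - \<theta>\<^sup>2 * h / 2) (\<theta> * g)
            - Complex (1 - \<theta>\<^sup>2 * (a\<^sup>2 + 2 * a * g + h) / 2) (\<theta> * (a + g)))
       \<le> \<bar>\<theta>\<bar> ^ 3 * (\<bar>a\<bar> ^ 3 * (1 + \<bar>h\<bar> + \<bar>g\<bar>) + (\<bar>a * h\<bar> + \<bar>g\<bar> * a\<^sup>2 + a\<^sup>2 * \<bar>h\<bar>))"
proof -
  define u where "u = Complex (1 - \<theta>\<^sup>2 * h / 2) (\<theta> * g)"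
  define p where "p = Complex (1 - \<theta>\<^sup>2 * a\<^sup>2 / 2) (\<theta> * a)"
  have p: "(\<Sum>k\<le>2. (\<i> * complex_of_real (\<theta> * a)) ^ k / fact k) = p"
    by (simp add: p_def numeral_2_eq_2 complex_eq_iff power2_eq_square)
  have R: "norm (iexp (\<theta> * a) - p) \<le> \<bar>\<theta>\<bar> ^ 3 * \<bar>a\<bar> ^ 3"
  proof -
    have "norm (iexp (\<theta> * a) - p) \<le> \<bar>\<theta> * a\<bar> ^ 3 / fact 3"
      using iexp_approx1[of "\<theta> * a" 2] unfolding p by (simp add: numeral_3_eq_3)
    also have "\<dots> \<le> \<bar>\<theta> * a\<bar> ^ 3 / 1" by (intro divide_left_mono) auto
    finally show ?thesis by (simp add: abs_mult power_mult_distrib)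
  qed
  have t2: "\<theta>\<^sup>2 \<le> 1" using assms by (simp add: abs_square_le_1)
  have U: "norm u \<le> 1 + \<bar>h\<bar> + \<bar>g\<bar>"
  proof -
    have "\<bar>\<theta>\<^sup>2 * h\<bar> \<le> \<bar>h\<bar>" "\<bar>\<theta> * g\<bar> \<le> \<bar>g\<bar>"
      using t2 assms by (auto simp: abs_mult intro!: mult_left_le_one_le)
    then have "\<bar>Re u\<bar> + \<bar>Im u\<bar> \<le> 1 + \<bar>h\<bar> + \<bar>g\<bar>" by (simp add: u_def)
    then show ?thesis using cmod_le[of u] by linarith
  qed
  have T: "p * u - Complex (1 - \<theta>\<^sup>2 * (a\<^sup>2 + 2 * a * g + h) / 2) (\<theta> * (a + g))
      = Complex (\<theta> ^ 3 * (\<theta> * a\<^sup>2 * h / 4)) (\<theta> ^ 3 * (- a * h / 2 - g * a\<^sup>2 / 2))"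
    by (simp add: p_def u_def complex_eq_iff power2_eq_square power3_eq_cube field_simps)
  have T': "norm (p * u - Complex (1 - \<theta>\<^sup>2 * (a\<^sup>2 + 2 * a * g + h) / 2) (\<theta> * (a + g)))
      \<le> \<bar>\<theta>\<bar> ^ 3 * (\<bar>a * h\<bar> + \<bar>g\<bar> * a\<^sup>2 + a\<^sup>2 * \<bar>h\<bar>)"
  proof -
    have "\<bar>\<theta> * a\<^sup>2 * h / 4\<bar> \<le> a\<^sup>2 * \<bar>h\<bar>"
    proof -
      have "\<bar>\<theta>\<bar> * (a\<^sup>2 * \<bar>h\<bar>) \<le> a\<^sup>2 * \<bar>h\<bar>" using assms by (intro mult_left_le_one_le) auto
      moreover have "\<bar>\<theta> * a\<^sup>2 * h / 4\<bar> = \<bar>\<theta>\<bar> * (a\<^sup>2 * \<bar>h\<bar>) / 4" by (simp add: abs_mult)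
      moreover have "a\<^sup>2 * \<bar>h\<bar> \<ge> 0" by simp
      ultimately show ?thesis by linarith
    qed
    moreover have "\<bar>- a * h / 2 - g * a\<^sup>2 / 2\<bar> \<le> \<bar>a * h\<bar> + \<bar>g\<bar> * a\<^sup>2"
    proof -
      have "\<bar>g * a\<^sup>2\<bar> = \<bar>g\<bar> * a\<^sup>2" by (simp add: abs_mult)
      then show ?thesis by (simp add: abs_le_iff) linarith
    qed
    ultimately have "\<bar>\<theta>\<bar> ^ 3 * \<bar>\<theta> * a\<^sup>2 * h / 4\<bar> + \<bar>\<theta>\<bar> ^ 3 * \<bar>- a * h / 2 - g * a\<^sup>2 / 2\<bar>
       \<le> \<bar>\<theta>\<bar> ^ 3 * (\<bar>a * h\<bar> + \<bar>g\<bar> * a\<^sup>2 + a\<^sup>2 * \<bar>h\<bar>)"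
      unfolding distrib_left[symmetric] by (intro mult_left_mono) auto
    then show ?thesis unfolding T
      using cmod_le[of "Complex (\<theta> ^ 3 * (\<theta> * a\<^sup>2 * h / 4)) (\<theta> ^ 3 * (- a * h / 2 - g * a\<^sup>2 / 2))"]
      by (simp only: complex.sel abs_mult[of "\<theta> ^ 3"] power_abs)
  qed
  have "norm ((iexp (\<theta> * a) - p) * u) \<le> (\<bar>\<theta>\<bar> ^ 3 * \<bar>a\<bar> ^ 3) * (1 + \<bar>h\<bar> + \<bar>g\<bar>)"
    unfolding norm_mult using R U by (intro mult_mono) auto
  moreover have "iexp (\<theta> * a) * u - Complex (1 - \<theta>\<^sup>2 * (a\<^sup>2 + 2 * a * g + h) / 2) (\<theta> * (a + g))
     = (iexp (\<theta> * a) - p) * u + (p * u - Complex (1 - \<theta>\<^sup>2 * (a\<^sup>2 + 2 * a * g + h) / 2) (\<theta> * (a + g)))"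
    by (simp add: algebra_simps)
  ultimately show ?thesis
    using T' norm_triangle_ineq[of "(iexp (\<theta> * a) - p) * u" "p * u - Complex (1 - \<theta>\<^sup>2 * (a\<^sup>2 + 2 * a * g + h) / 2) (\<theta> * (a + g))"]
    unfolding u_def[symmetric] by (simp only: distrib_left mult.assoc)
qed

section \<open>Characteristic functions of the centred surprisal and weak convergence\<close>

context markov_source
begin

text \<open>\<open>u \<theta>\<close> is an eigenvector, up to \<open>O(\<theta>\<^sup>3)\<close>, of the tilted transition operator with
  eigenvalue \<open>1 - V \<theta>\<^sup>2 / 2\<close>; its Taylor coefficients are the two correctors.\<close>

definition u :: "real \<Rightarrow> nat \<Rightarrow> complex" where
  "u \<theta> x = Complex (1 - \<theta>\<^sup>2 * h x / 2) (\<theta> * g x)"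

text \<open>Averaging the expansion over \<open>y\<close>, the equations \<open>g_eq\<close> and
  \<open>h_eq\<close> collapse it to 1 - \<theta>^2 (h + V) / 2 + i \<theta> g. This differs from
  the claimed multiple of \<open>u\<close> only in orders 3 and 4. Finiteness of the state space
  makes the constant uniform.\<close>

lemma tilted_eigenvector:
  "\<exists>C\<ge>0. \<forall>\<theta> x. \<bar>\<theta>\<bar> \<le> 1 \<longrightarrow> x < d \<longrightarrow>
     norm ((\<Sum>y<d. Q y x *\<^sub>R (iexp (\<theta> * inc y x) * u \<theta> y)) - complex_of_real (1 - V * \<theta>\<^sup>2 / 2) * u \<theta> x) \<le> C * \<bar>\<theta>\<bar> ^ 3"
proof -
  define D where "D x y = \<bar>inc y x\<bar> ^ 3 * (1 + \<bar>h y\<bar> + \<bar>g y\<bar>)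
     + (\<bar>inc y x * h y\<bar> + \<bar>g y\<bar> * (inc y x)\<^sup>2 + (inc y x)\<^sup>2 * \<bar>h y\<bar>)" for x y
  define E where "E x = (\<Sum>y<d. Q y x * D x y) + (\<bar>V * g x\<bar> + \<bar>V * h x\<bar>)" for x
  have bound: "norm ((\<Sum>y<d. Q y x *\<^sub>R (iexp (\<theta> * inc y x) * u \<theta> y)) - complex_of_real (1 - V * \<theta>\<^sup>2 / 2) * u \<theta> x)
     \<le> E x * \<bar>\<theta>\<bar> ^ 3" if \<theta>: "\<bar>\<theta>\<bar> \<le> 1" and x: "x < d" for \<theta> x
  proof -
    define p where "p y = Complex (1 - \<theta>\<^sup>2 * ((inc y x)\<^sup>2 + 2 * inc y x * g y + h y) / 2) (\<theta> * (inc y x + g y))" for y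
    have "(\<Sum>y<d. Q y x *\<^sub>R p y) = Complex (1 - \<theta>\<^sup>2 * (h x + V) / 2) (\<theta> * g x)"
    proof (rule complex_eqI)
      have "Re (\<Sum>y<d. Q y x *\<^sub>R p y) = (\<Sum>y<d. Q y x) - \<theta>\<^sup>2 / 2 * (\<Sum>y<d. Q y x * ((inc y x)\<^sup>2 + 2 * inc y x * g y + h y))"
        unfolding sum_distrib_left sum_subtractf[symmetric] Re_sum
        by (intro sum.cong) (auto simp: p_def algebra_simps)
      then show "Re (\<Sum>y<d. Q y x *\<^sub>R p y) = Re (Complex (1 - \<theta>\<^sup>2 * (h x + V) / 2) (\<theta> * g x))"
        using h_eq[OF x] Q_sum[OF x] by simp
      have "Im (\<Sum>y<d. Q y x *\<^sub>R p y) = \<theta> * (\<Sum>y<d. Q y x * (inc y x + g y))"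
        unfolding sum_distrib_left Im_sum by (intro sum.cong) (auto simp: p_def algebra_simps)
      then show "Im (\<Sum>y<d. Q y x *\<^sub>R p y) = Im (Complex (1 - \<theta>\<^sup>2 * (h x + V) / 2) (\<theta> * g x))"
        using g_eq[OF x] by simp
    qed
    then have B: "(\<Sum>y<d. Q y x *\<^sub>R p y) - complex_of_real (1 - V * \<theta>\<^sup>2 / 2) * u \<theta> x
        = Complex (\<theta> ^ 3 * (- \<theta> * V * h x / 4)) (\<theta> ^ 3 * (V * g x / 2))"
      by (simp add: u_def complex_eq_iff power2_eq_square power3_eq_cube field_simps)
    have B': "norm ((\<Sum>y<d. Q y x *\<^sub>R p y) - complex_of_real (1 - V * \<theta>\<^sup>2 / 2) * u \<theta> x)
        \<le> \<bar>\<theta>\<bar> ^ 3 * (\<bar>V * g x\<bar> + \<bar>V * h x\<bar>)"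
    proof -
      have "\<bar>- \<theta> * V * h x / 4\<bar> \<le> \<bar>V * h x\<bar>"
      proof -
        have "\<bar>\<theta>\<bar> * \<bar>V * h x\<bar> \<le> \<bar>V * h x\<bar>" using \<theta> by (intro mult_left_le_one_le) auto
        moreover have "\<bar>- \<theta> * V * h x / 4\<bar> = \<bar>\<theta>\<bar> * \<bar>V * h x\<bar> / 4" by (simp add: abs_mult)
        ultimately show ?thesis by linarith
      qed
      then have "\<bar>\<theta>\<bar> ^ 3 * \<bar>- \<theta> * V * h x / 4\<bar> + \<bar>\<theta>\<bar> ^ 3 * \<bar>V * g x / 2\<bar> \<le> \<bar>\<theta>\<bar> ^ 3 * (\<bar>V * g x\<bar> + \<bar>V * h x\<bar>)"
        unfolding distrib_left[symmetric] by (intro mult_left_mono) auto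
      then show ?thesis unfolding B
        using cmod_le[of "Complex (\<theta> ^ 3 * (- \<theta> * V * h x / 4)) (\<theta> ^ 3 * (V * g x / 2))"]
        by (simp only: complex.sel abs_mult[of "\<theta> ^ 3"] power_abs)
    qed
    have "norm (\<Sum>y<d. Q y x *\<^sub>R (iexp (\<theta> * inc y x) * u \<theta> y - p y)) \<le> (\<Sum>y<d. Q y x * (\<bar>\<theta>\<bar> ^ 3 * D x y))"
    proof (rule sum_norm_le)
      fix y assume y: "y \<in> {..<d}"
      have "norm (iexp (\<theta> * inc y x) * u \<theta> y - p y) \<le> \<bar>\<theta>\<bar> ^ 3 * D x y"
        unfolding u_def p_def D_def by (rule iexp_mult_corrector_bound[OF \<theta>])
      moreover have "Q y x \<ge> 0" using y x by (intro Q_nonneg) auto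
      ultimately show "norm (Q y x *\<^sub>R (iexp (\<theta> * inc y x) * u \<theta> y - p y)) \<le> Q y x * (\<bar>\<theta>\<bar> ^ 3 * D x y)"
        by (simp add: mult_left_mono)
    qed
    also have "(\<Sum>y<d. Q y x * (\<bar>\<theta>\<bar> ^ 3 * D x y)) = \<bar>\<theta>\<bar> ^ 3 * (\<Sum>y<d. Q y x * D x y)"
      unfolding sum_distrib_left by (intro sum.cong) auto
    finally have A: "norm (\<Sum>y<d. Q y x *\<^sub>R (iexp (\<theta> * inc y x) * u \<theta> y - p y)) \<le> \<bar>\<theta>\<bar> ^ 3 * (\<Sum>y<d. Q y x * D x y)" .
    have eq: "(\<Sum>y<d. Q y x *\<^sub>R (iexp (\<theta> * inc y x) * u \<theta> y)) - complex_of_real (1 - V * \<theta>\<^sup>2 / 2) * u \<theta> x =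
      (\<Sum>y<d. Q y x *\<^sub>R (iexp (\<theta> * inc y x) * u \<theta> y - p y)) + ((\<Sum>y<d. Q y x *\<^sub>R p y) - complex_of_real (1 - V * \<theta>\<^sup>2 / 2) * u \<theta> x)"
      by (simp add: scaleR_diff_right sum_subtractf)
    have "E x * \<bar>\<theta>\<bar> ^ 3 = \<bar>\<theta>\<bar> ^ 3 * (\<Sum>y<d. Q y x * D x y) + \<bar>\<theta>\<bar> ^ 3 * (\<bar>V * g x\<bar> + \<bar>V * h x\<bar>)"
      by (simp add: E_def algebra_simps)
    then show ?thesis unfolding eq using A B' by (simp only:) (intro norm_triangle_mono)
  qed
  obtain C where "C \<ge> 0" "\<And>x. x < d \<Longrightarrow> \<bar>E x\<bar> \<le> C" using bounded_on_lessThan[of d E] by blast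
  then have "E x * \<bar>\<theta>\<bar> ^ 3 \<le> C * \<bar>\<theta>\<bar> ^ 3" if "x < d" for \<theta> x
    using that by (intro mult_right_mono) (auto simp: abs_le_iff)
  then show ?thesis using bound \<open>C \<ge> 0\<close> by (meson order_trans)
qed

text \<open>Each step multiplies by \<rho> up to an error of at most \<open>C\<close>. Since \<rho>
  has modulus at most 1, earlier errors are not amplified and the errors merely add up.\<close>

lemma wexp_iexp_approx:
  assumes C: "\<And>x. x < d \<Longrightarrow>
     norm ((\<Sum>y<d. Q y x *\<^sub>R (iexp (\<theta> * inc y x) * u \<theta> y)) - complex_of_real \<rho> * u \<theta> x) \<le> C"
    and l: "\<bar>\<rho>\<bar> \<le> 1"
  shows "norm (wexp n (\<lambda>z. iexp (\<theta> * S n z) * u \<theta> (last_state s0 n z)) - complex_of_real \<rho> ^ n * u \<theta> s0) \<le> real n * C"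
proof (induction n)
  case 0
  show ?case by (simp add: wexp_0 last_state_def)
next
  case (Suc n)
  define A where "A n = wexp n (\<lambda>z. iexp (\<theta> * S n z) * u \<theta> (last_state s0 n z))" for n
  have "A (Suc n) = wexp n (\<lambda>z. iexp (\<theta> * S n z) * (\<Sum>y<d. Q y (last_state s0 n z) *\<^sub>R (iexp (\<theta> * inc y (last_state s0 n z)) * u \<theta> y)))"
    unfolding A_def wexp_Suc
    by (intro wexp_cong) (simp add: S_Suc distrib_left exp_add sum_distrib_left mult.assoc)
  moreover have "\<dots> - complex_of_real \<rho> * A n = wexp n (\<lambda>z. iexp (\<theta> * S n z) *
     ((\<Sum>y<d. Q y (last_state s0 n z) *\<^sub>R (iexp (\<theta> * inc y (last_state s0 n z)) * u \<theta> y)) - complex_of_real \<rho> * u \<theta> (last_state s0 n z)))"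
    unfolding A_def wexp_mult_left[symmetric] wexp_diff[symmetric]
    by (intro wexp_cong) (simp add: algebra_simps)
  moreover have "norm \<dots> \<le> C"
  proof (intro norm_wexp_bound)
    fix z assume "z \<in> words d n"
    from C[OF last_state_less[OF this]] show "norm (iexp (\<theta> * S n z) *
     ((\<Sum>y<d. Q y (last_state s0 n z) *\<^sub>R (iexp (\<theta> * inc y (last_state s0 n z)) * u \<theta> y)) - complex_of_real \<rho> * u \<theta> (last_state s0 n z))) \<le> C"
      by (simp only: norm_mult norm_exp_i_times mult_1_left)
  qed
  ultimately have 1: "norm (A (Suc n) - complex_of_real \<rho> * A n) \<le> C" by (simp only:)
  have eq: "A (Suc n) - complex_of_real \<rho> ^ Suc n * u \<theta> s0
     = (A (Suc n) - complex_of_real \<rho> * A n) + complex_of_real \<rho> * (A n - complex_of_real \<rho> ^ n * u \<theta> s0)"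
    by (simp add: algebra_simps)
  have "norm (complex_of_real \<rho> * (A n - complex_of_real \<rho> ^ n * u \<theta> s0)) \<le> real n * C"
    unfolding norm_mult using Suc l unfolding A_def[symmetric]
    by (intro order_trans[OF mult_left_le_one_le]) auto
  then have "norm (A (Suc n) - complex_of_real \<rho> ^ Suc n * u \<theta> s0) \<le> C + real n * C"
    unfolding eq using 1 by (intro norm_triangle_le) linarith
  then show ?case by (simp add: A_def algebra_simps)
qed

text \<open>With \<theta> of order 1 / sqrt n the accumulated error n |\<theta>|^3 vanishes,
  \<open>u\<close> tends to 1 at both ends of the path, and \<open>V\<close> cancels so that
  \<rho>^n = (1 - t^2 / (2n))^n. The sign is chosen because \<open>- S\<close> is the deviation of
  the log-likelihood.\<close>

lemma char_limit:
  assumes V: "V > 0"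
  shows "(\<lambda>n. wexp n (\<lambda>z. iexp (t * (- S n z / sqrt (V * real n))))) \<longlonglongrightarrow> exp (- (t\<^sup>2) / 2)"
proof -
  obtain C where C: "C \<ge> 0" "\<And>\<theta> x. \<bar>\<theta>\<bar> \<le> 1 \<Longrightarrow> x < d \<Longrightarrow>
     norm ((\<Sum>y<d. Q y x *\<^sub>R (iexp (\<theta> * inc y x) * u \<theta> y)) - complex_of_real (1 - V * \<theta>\<^sup>2 / 2) * u \<theta> x) \<le> C * \<bar>\<theta>\<bar> ^ 3"
    using tilted_eigenvector by blast
  obtain G where G: "G \<ge> 0" "\<And>x. x < d \<Longrightarrow> \<bar>g x\<bar> \<le> G" using bounded_on_lessThan[of d g] by blast
  obtain K where K: "K \<ge> 0" "\<And>x. x < d \<Longrightarrow> \<bar>h x\<bar> \<le> K" using bounded_on_lessThan[of d h] by blast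
  define \<theta> where "\<theta> n = - t / sqrt (V * real n)" for n
  define \<rho> where "\<rho> n = 1 - V * (\<theta> n)\<^sup>2 / 2" for n
  define b where "b n = \<bar>\<theta> n\<bar> * G + (\<theta> n)\<^sup>2 * K" for n
  have ub: "norm (u (\<theta> n) x - 1) \<le> b n" if "x < d" for n x
  proof -
    have "norm (u (\<theta> n) x - 1) \<le> \<bar>(\<theta> n)\<^sup>2 * h x / 2\<bar> + \<bar>\<theta> n * g x\<bar>"
      using cmod_le[of "u (\<theta> n) x - 1"] by (simp add: u_def)
    also have "\<dots> \<le> (\<theta> n)\<^sup>2 * K + \<bar>\<theta> n\<bar> * G"
    proof -
      have "(\<theta> n)\<^sup>2 * \<bar>h x\<bar> \<le> (\<theta> n)\<^sup>2 * K" "\<bar>\<theta> n\<bar> * \<bar>g x\<bar> \<le> \<bar>\<theta> n\<bar> * G"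
        using G K that by (auto intro!: mult_left_mono)
      moreover have "(\<theta> n)\<^sup>2 * \<bar>h x\<bar> \<ge> 0" by simp
      moreover have "\<bar>(\<theta> n)\<^sup>2 * h x / 2\<bar> = (\<theta> n)\<^sup>2 * \<bar>h x\<bar> / 2" "\<bar>\<theta> n * g x\<bar> = \<bar>\<theta> n\<bar> * \<bar>g x\<bar>"
        by (simp_all add: abs_mult)
      ultimately show ?thesis by linarith
    qed
    finally show ?thesis by (simp add: b_def)
  qed
  have ev: "\<forall>\<^sub>F n in sequentially. norm (wexp n (\<lambda>z. iexp (t * (- S n z / sqrt (V * real n)))) - complex_of_real (\<rho> n ^ n))
     \<le> real n * (C * \<bar>\<theta> n\<bar> ^ 3) + 2 * b n"
  proof -
    have "(\<lambda>n. k / sqrt (real n)) \<longlonglongrightarrow> 0" for k by real_asymp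
    moreover have "\<theta> = (\<lambda>n. (- t / sqrt V) / sqrt (real n))"
      by (simp add: fun_eq_iff \<theta>_def real_sqrt_mult)
    ultimately have "\<theta> \<longlonglongrightarrow> 0" by (simp only:)
    then have e1: "\<forall>\<^sub>F n in sequentially. \<bar>\<theta> n\<bar> \<le> 1"
      using tendstoD[of \<theta> 0 sequentially 1] by (auto elim!: eventually_mono)
    have "(\<lambda>n. V * (\<theta> n)\<^sup>2 / 2) \<longlonglongrightarrow> V * 0\<^sup>2 / 2" by (intro tendsto_intros \<open>\<theta> \<longlonglongrightarrow> 0\<close>) auto
    then have e2: "\<forall>\<^sub>F n in sequentially. V * (\<theta> n)\<^sup>2 / 2 < 1"
      by (rule order_tendstoD) simp
    show ?thesis using e1 e2
    proof eventually_elim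
      case (elim n)
      have l: "\<bar>\<rho> n\<bar> \<le> 1" using elim(2) V by (simp add: \<rho>_def abs_le_iff)
      have 1: "norm (wexp n (\<lambda>z. iexp (\<theta> n * S n z) * u (\<theta> n) (last_state s0 n z)) - complex_of_real (\<rho> n) ^ n * u (\<theta> n) s0) \<le> real n * (C * \<bar>\<theta> n\<bar> ^ 3)"
        using C(2)[OF elim(1)] l by (intro wexp_iexp_approx) (auto simp: \<rho>_def)
      have "norm (wexp n (\<lambda>z. iexp (\<theta> n * S n z) * (u (\<theta> n) (last_state s0 n z) - 1))) \<le> b n"
        by (intro norm_wexp_bound) (auto simp: norm_mult intro!: ub last_state_less)
      moreover have "wexp n (\<lambda>z. iexp (\<theta> n * S n z) * (u (\<theta> n) (last_state s0 n z) - 1))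
        = wexp n (\<lambda>z. iexp (\<theta> n * S n z) * u (\<theta> n) (last_state s0 n z)) - wexp n (\<lambda>z. iexp (\<theta> n * S n z))"
        by (simp add: right_diff_distrib wexp_diff)
      ultimately have 2: "norm (wexp n (\<lambda>z. iexp (\<theta> n * S n z) * u (\<theta> n) (last_state s0 n z)) - wexp n (\<lambda>z. iexp (\<theta> n * S n z))) \<le> b n"
        by simp
      have "norm (complex_of_real (\<rho> n) ^ n * (u (\<theta> n) s0 - 1)) \<le> 1 * b n"
        unfolding norm_mult using l s0
        by (intro mult_mono ub) (auto simp: norm_power power_le_one)
      then have 3: "norm (complex_of_real (\<rho> n) ^ n * u (\<theta> n) s0 - complex_of_real (\<rho> n ^ n)) \<le> b n"
        by (simp add: right_diff_distrib)
      have "wexp n (\<lambda>z. iexp (t * (- S n z / sqrt (V * real n)))) = wexp n (\<lambda>z. iexp (\<theta> n * S n z))"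
        by (simp add: \<theta>_def)
      \<comment> \<open>The three errors: iterating the approximate eigenvalue, dropping
        \<open>u\<close> at the final state, and dropping \<open>u\<close> at the initial
        state.\<close>
      moreover have "norm (x - w) \<le> norm (y - z) + norm (y - x) + norm (z - w)" for x y z w :: complex
        by norm
      ultimately show ?case using 1 2 3 by (smt (verit))
    qed
  qed
  have "(\<lambda>n. real n * (C * \<bar>\<theta> n\<bar> ^ 3) + 2 * b n) \<longlonglongrightarrow> 0"
  proof -
    define k where "k = \<bar>t\<bar> / sqrt V"
    have ab: "\<bar>\<theta> n\<bar> = k / sqrt (real n)" for n using V by (simp add: \<theta>_def k_def real_sqrt_mult abs_mult)
    have sq: "(\<theta> n)\<^sup>2 = (k / sqrt (real n))\<^sup>2" for n by (metis ab power2_abs)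
    have "(\<lambda>n. real n * (1 / sqrt (real n)) ^ 3) \<longlonglongrightarrow> 0" "(\<lambda>n. 1 / sqrt (real n)) \<longlonglongrightarrow> 0"
      by real_asymp+
    then have "(\<lambda>n. C * k ^ 3 * (real n * (1 / sqrt (real n)) ^ 3)
        + 2 * (k * (1 / sqrt (real n)) * G + (k * (1 / sqrt (real n)))\<^sup>2 * K))
      \<longlonglongrightarrow> C * k ^ 3 * 0 + 2 * (k * 0 * G + (k * 0)\<^sup>2 * K)"
      by (intro tendsto_intros)
    then show ?thesis unfolding b_def ab sq by (simp add: power_divide mult_ac)
  qed
  then have "(\<lambda>n. wexp n (\<lambda>z. iexp (t * (- S n z / sqrt (V * real n)))) - complex_of_real (\<rho> n ^ n)) \<longlonglongrightarrow> 0"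
    by (rule Lim_null_comparison[OF ev])
  moreover have "(\<lambda>n. complex_of_real (\<rho> n ^ n)) \<longlonglongrightarrow> complex_of_real (exp (- (t\<^sup>2) / 2))"
  proof -
    have "(\<lambda>n. (1 + (- (t\<^sup>2) / 2) / real n) ^ n) \<longlonglongrightarrow> exp (- (t\<^sup>2) / 2)" by (rule tendsto_exp_limit_sequentially)
    moreover have "\<rho> n = 1 + (- (t\<^sup>2) / 2) / real n" for n
      using V by (simp add: \<rho>_def \<theta>_def power_divide)
    ultimately show ?thesis by (intro tendsto_of_real) simp
  qed
  ultimately show ?thesis
    using tendsto_add by (fastforce simp: exp_of_real)
qed

text \<open>Packages the weights of \<open>wexp\<close> as a probability measure, as needed for
  Levy's continuity theorem.\<close>

definition word_pmf :: "nat \<Rightarrow> (nat \<Rightarrow> nat) pmf" where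
  "word_pmf n = embed_pmf (\<lambda>z. if z \<in> words d n then markov_prob Q s0 n z else 0)"

lemma pmf_word_pmf: "pmf (word_pmf n) z = (if z \<in> words d n then markov_prob Q s0 n z else 0)"
  unfolding word_pmf_def
proof (rule pmf_embed_pmf)
  have "(\<integral>\<^sup>+ z. ennreal (if z \<in> words d n then markov_prob Q s0 n z else 0) \<partial>count_space UNIV)
      = (\<Sum>z\<in>words d n. ennreal (markov_prob Q s0 n z))"
    by (subst nn_integral_count_space'[of "words d n"]) auto
  also have "\<dots> = ennreal (wexp n (\<lambda>_. 1))"
    by (simp add: wexp_real sum_ennreal markov_prob_nonneg)
  finally show "(\<integral>\<^sup>+ z. ennreal (if z \<in> words d n then markov_prob Q s0 n z else 0) \<partial>count_space UNIV) = 1"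
    by (simp add: wexp_const)
qed (auto simp: markov_prob_nonneg)

lemma integral_word_pmf:
  fixes F :: "_ \<Rightarrow> 'b::{banach, second_countable_topology}"
  shows "(LINT z|word_pmf n. F z) = wexp n F"
  unfolding wexp_def
  by (subst integral_measure_pmf[of "words d n"]) (auto simp: set_pmf_eq pmf_word_pmf split: if_splits)

text \<open>Levy's theorem turns \<open>char_limit\<close> into weak convergence, and continuity of
  the limiting distribution function makes the convergence hold at every point.\<close>

theorem markov_clt:
  assumes V: "V > 0"
  shows "(\<lambda>n. wexp n (\<lambda>z. of_bool (- S n z / sqrt (V * real n) \<le> x))) \<longlonglongrightarrow> Gauss_cdf x"
proof -
  define X where "X n z = - S n z / sqrt (V * real n)" for n z
  define M where "M n = distr (measure_pmf (word_pmf n)) borel (X n)" for n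
  have real_dist: "real_distribution (M n)" for n
    unfolding M_def by (rule prob_space.real_distribution_distr) (auto intro: measure_pmf.prob_space_axioms)
  have char: "char (M n) t = wexp n (\<lambda>z. iexp (t * X n z))" for n t
    unfolding char_def M_def by (subst integral_distr) (auto simp: integral_word_pmf)
  have cdf: "cdf (M n) x = wexp n (\<lambda>z. of_bool (X n z \<le> x))" for n
  proof -
    have "cdf (M n) x = measure (word_pmf n) {z. X n z \<le> x}"
      unfolding cdf_def M_def by (subst measure_distr) (auto simp: vimage_def)
    also have "\<dots> = (LINT z|word_pmf n. indicator {z. X n z \<le> x} z)" by simp
    also have "\<dots> = wexp n (indicator {z. X n z \<le> x})" by (rule integral_word_pmf)
    also have "indicator {z. X n z \<le> x} = (\<lambda>z. of_bool (X n z \<le> x) :: real)" by auto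
    finally show ?thesis .
  qed
  have "weak_conv_m M std_normal_distribution"
  proof (rule levy_continuity[OF real_dist real_dist_normal_dist])
    fix t show "(\<lambda>n. char (M n) t) \<longlonglongrightarrow> char std_normal_distribution t"
      using char_limit[OF V, of t] by (simp add: char X_def char_std_normal_distribution)
  qed
  then have "(\<lambda>n. cdf (M n) x) \<longlonglongrightarrow> cdf std_normal_distribution x"
    using isCont_Gauss_cdf[of x] unfolding weak_conv_m_def weak_conv_def Gauss_cdf_eq by blast
  then show ?thesis by (simp add: cdf X_def Gauss_cdf_eq)
qed

end

section \<open>Converse and Feinstein bounds\<close>

lemma mod_diff_eq_if:
  fixes a x d :: nat
  assumes "a < d" "x < d"
  shows "(a + d - x) mod d = (if x \<le> a then a - x else a + d - x)"
proof (cases "x \<le> a")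
  case True
  then have "a + d - x = (a - x) + d" by simp
  then have "(a + d - x) mod d = (a - x) mod d" by (simp only: mod_add_self2)
  then show ?thesis using True assms by simp
qed (use assms in auto)

lemma sub_mod_words: "d > 0 \<Longrightarrow> sub_mod d n y x \<in> words d n"
  by (auto simp: sub_mod_def words_def PiE_def extensional_def)

lemma sub_mod_apply:
  assumes "x \<in> words d n" "y \<in> words d n" "i < n"
  shows "sub_mod d n y x i = (if x i \<le> y i then y i - x i else y i + d - x i)"
  using assms by (simp add: sub_mod_def mod_diff_eq_if words_less)

lemma words_eqI:
  assumes "x \<in> words d n" "y \<in> words d n" "\<And>i. i < n \<Longrightarrow> x i = y i"
  shows "x = y"
  using assms unfolding words_def by (intro PiE_ext[of x _ _ y]) auto

text \<open>Together with \<open>inj_on_sub_mod_right\<close>, this makes every row and every column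
  of the channel matrix a rearrangement of the noise law.\<close>

lemma inj_on_sub_mod_left:
  assumes x: "x \<in> words d n"
  shows "inj_on (\<lambda>y. sub_mod d n y x) (words d n)"
proof (rule inj_onI)
  fix y y' assume y: "y \<in> words d n" "y' \<in> words d n" "sub_mod d n y x = sub_mod d n y' x"
  show "y = y'"
  proof (rule words_eqI[OF y(1,2)])
    fix i assume i: "i < n"
    show "y i = y' i"
      using fun_cong[OF y(3), of i] words_less[OF x i] words_less[OF y(1) i] words_less[OF y(2) i]
      unfolding sub_mod_apply[OF x y(1) i] sub_mod_apply[OF x y(2) i] by (auto split: if_splits)
  qed
qed

lemma inj_on_sub_mod_right:
  assumes y: "y \<in> words d n"
  shows "inj_on (\<lambda>x. sub_mod d n y x) (words d n)"
proof (rule inj_onI)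
  fix x x' assume x: "x \<in> words d n" "x' \<in> words d n" "sub_mod d n y x = sub_mod d n y x'"
  show "x = x'"
  proof (rule words_eqI[OF x(1,2)])
    fix i assume i: "i < n"
    show "x i = x' i"
      using fun_cong[OF x(3), of i] words_less[OF y i] words_less[OF x(1) i] words_less[OF x(2) i]
      unfolding sub_mod_apply[OF x(1) y i] sub_mod_apply[OF x(2) y i] by (auto split: if_splits)
  qed
qed

lemma sum_words_reindex:
  assumes "inj_on f (words d n)" "\<And>z. z \<in> words d n \<Longrightarrow> f z \<in> words d n"
  shows "(\<Sum>z\<in>words d n. F (f z)) = (\<Sum>z\<in>words d n. F z)"
proof -
  have "f ` words d n = words d n" using assms by (intro endo_inj_surj) auto
  then show ?thesis using sum.reindex[OF assms(1), of F] by simp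
qed

section \<open>Coding bounds at fixed block length\<close>

context markov_source
begin

abbreviation "W n \<equiv> chan_AM d Q s0 n"

abbreviation "mp n \<equiv> markov_prob Q s0 n"

lemma d_gt_0: "d > 0" using d_pos by simp

lemma sum_W_output:
  assumes "x \<in> words d n"
  shows "(\<Sum>y\<in>words d n. F (W n y x)) = (\<Sum>z\<in>words d n. F (mp n z))"
  unfolding chan_AM_def
  by (rule sum_words_reindex[OF inj_on_sub_mod_left[OF assms]]) (simp add: sub_mod_words d_gt_0)

text \<open>For a fixed output the inputs also sweep through all noise words, so each column sums to
  one: a uniform input has a uniform output.\<close>

lemma sum_W_input:
  assumes "y \<in> words d n"
  shows "(\<Sum>x\<in>words d n. F (W n y x)) = (\<Sum>z\<in>words d n. F (mp n z))"
  unfolding chan_AM_def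
  by (rule sum_words_reindex[OF inj_on_sub_mod_right[OF assms]]) (simp add: sub_mod_words d_gt_0)

lemma sum_mp: "(\<Sum>z\<in>words d n. mp n z) = 1"
  using wexp_const[of n "1::real"] by (simp add: wexp_real)

lemma W_nonneg: "W n y x \<ge> 0"
  unfolding chan_AM_def by (intro markov_prob_nonneg sub_mod_words d_gt_0)

text \<open>Split each decoding set at likelihood \<gamma>. The part above has probability at most
  \<open>w\<close>, the same for every codeword by additivity; each remaining word contributes at
  most \<gamma>. Disjointness limits the decoding sets to \<open>d^n\<close> words
  altogether.\<close>

lemma converse_bound:
  assumes code: "is_code d n N \<phi> D" and \<gamma>: "\<gamma> > 0"
  shows "err_prob d Q s0 n N \<phi> D \<ge> 1 - wexp n (\<lambda>z. of_bool (mp n z > \<gamma>)) - \<gamma> * real d ^ n / real N"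
proof -
  have N: "real N > 0" using code by (simp add: is_code_def)
  define w :: real where "w = wexp n (\<lambda>z. of_bool (mp n z > \<gamma>))"
  have sub: "D i \<subseteq> words d n" "\<phi> i \<in> words d n" if "i \<in> {1..N}" for i
    using code that by (auto simp: is_code_def)
  have fin: "finite (D i)" if "i \<in> {1..N}" for i using sub(1)[OF that] finite_words finite_subset by metis
  have one: "(\<Sum>y\<in>D i. W n y (\<phi> i)) \<le> w + \<gamma> * card (D i)" if i: "i \<in> {1..N}" for i
  proof -
    have "(\<Sum>y\<in>D i. W n y (\<phi> i)) \<le> (\<Sum>y\<in>D i. W n y (\<phi> i) * of_bool (W n y (\<phi> i) > \<gamma>) + \<gamma>)"
      using \<gamma> by (intro sum_mono) auto
    also have "\<dots> = (\<Sum>y\<in>D i. W n y (\<phi> i) * of_bool (W n y (\<phi> i) > \<gamma>)) + \<gamma> * card (D i)"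
      by (simp add: sum.distrib)
    also have "(\<Sum>y\<in>D i. W n y (\<phi> i) * of_bool (W n y (\<phi> i) > \<gamma>)) \<le> (\<Sum>y\<in>words d n. W n y (\<phi> i) * of_bool (W n y (\<phi> i) > \<gamma>))"
      using sub[OF i] by (intro sum_mono2) (auto simp: W_nonneg)
    also have "\<dots> = w"
      unfolding w_def wexp_real by (rule sum_W_output[OF sub(2)[OF i], where F = "\<lambda>p. p * of_bool (p > \<gamma>)"])
    finally show ?thesis by simp
  qed
  have "(\<Sum>i=1..N. card (D i)) = card (\<Union>i\<in>{1..N}. D i)"
    using code fin by (subst card_UN_disjoint) (auto simp: is_code_def)
  also have "\<dots> \<le> card (words d n)" using sub(1) by (intro card_mono finite_words UN_least)
  finally have "(\<Sum>i=1..N. real (card (D i))) \<le> real (d ^ n)" unfolding card_words by (metis of_nat_le_iff of_nat_sum)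
  then have card: "(\<Sum>i=1..N. real (card (D i))) \<le> real d ^ n" by simp
  have "real N - (\<Sum>i=1..N. 1 - (\<Sum>y\<in>D i. W n y (\<phi> i))) = (\<Sum>i=1..N. \<Sum>y\<in>D i. W n y (\<phi> i))"
    by (simp add: sum_subtractf)
  also have "\<dots> \<le> (\<Sum>i=1..N. w + \<gamma> * card (D i))" by (intro sum_mono one)
  also have "\<dots> = real N * w + \<gamma> * (\<Sum>i=1..N. real (card (D i)))" by (simp add: sum.distrib sum_distrib_left)
  also have "\<dots> \<le> real N * w + \<gamma> * real d ^ n" using card \<gamma> by (intro add_left_mono mult_left_mono) auto
  finally have "real N - real N * w - \<gamma> * real d ^ n \<le> (\<Sum>i=1..N. 1 - (\<Sum>y\<in>D i. W n y (\<phi> i)))" by simp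
  then have "(real N - real N * w - \<gamma> * real d ^ n) / real N \<le> (\<Sum>i=1..N. 1 - (\<Sum>y\<in>D i. W n y (\<phi> i))) / real N"
    using N by (intro divide_right_mono) auto
  moreover have "(real N - real N * w - \<gamma> * real d ^ n) / real N = 1 - w - \<gamma> * real d ^ n / real N"
    using N by (simp add: diff_divide_distrib)
  ultimately show ?thesis by (simp add: err_prob_def w_def)
qed

text \<open>Feinstein's greedy construction. If no further codeword could be added, averaging over
  all inputs would contradict that a uniform input yields a uniform output.\<close>

lemma feinstein_step:
  assumes \<gamma>: "\<gamma> > 0" and U: "U \<subseteq> words d n" "real (card U) < real N / \<gamma>"
    and \<epsilon>: "\<epsilon> = 1 - wexp n (\<lambda>z. of_bool (mp n z > \<gamma>)) + real N / (\<gamma> * real d ^ n)"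
  shows "\<exists>x\<in>words d n. (\<Sum>y\<in>{y \<in> words d n. W n y x > \<gamma>} - U. W n y x) \<ge> 1 - \<epsilon>"
proof (rule ccontr)
  assume "\<not> ?thesis"
  then have less: "(\<Sum>y\<in>{y \<in> words d n. W n y x > \<gamma>} - U. W n y x) \<le> 1 - \<epsilon>" if "x \<in> words d n" for x
    using that by fastforce
  define w :: real where "w = wexp n (\<lambda>z. of_bool (mp n z > \<gamma>))"
  have finU: "finite U" using U(1) finite_words finite_subset by metis
  have dn: "real d ^ n > 0" using d_gt_0 by simp
  have "w \<le> (1 - \<epsilon>) + (\<Sum>y\<in>U. W n y x)" if x: "x \<in> words d n" for x
  proof -
    have "w = (\<Sum>y\<in>words d n. W n y x * of_bool (W n y x > \<gamma>))"
      unfolding w_def wexp_real by (rule sum_W_output[OF x, where F = "\<lambda>p. p * of_bool (p > \<gamma>)", symmetric])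
    also have "\<dots> = (\<Sum>y\<in>{y \<in> words d n. W n y x > \<gamma>}. W n y x)"
      by (intro sum.mono_neutral_cong_right) auto
    also have "\<dots> \<le> (\<Sum>y\<in>({y \<in> words d n. W n y x > \<gamma>} - U) \<union> U. W n y x)"
      using finU by (intro sum_mono2) (auto simp: W_nonneg)
    also have "\<dots> = (\<Sum>y\<in>({y \<in> words d n. W n y x > \<gamma>} - U). W n y x) + (\<Sum>y\<in>U. W n y x)"
      using finU by (intro sum.union_disjoint) auto
    finally show ?thesis using less[OF x] by simp
  qed
  then have "(\<Sum>x\<in>words d n. w) \<le> (\<Sum>x\<in>words d n. (1 - \<epsilon>) + (\<Sum>y\<in>U. W n y x))" by (rule sum_mono)
  also have "\<dots> = real d ^ n * (1 - \<epsilon>) + (\<Sum>y\<in>U. \<Sum>x\<in>words d n. W n y x)"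
    by (simp add: sum.distrib card_words) (rule sum.swap)
  also have "(\<Sum>y\<in>U. \<Sum>x\<in>words d n. W n y x) = (\<Sum>y\<in>U. 1)"
    using U(1) sum_W_input[of _ n "\<lambda>p. p"] sum_mp by (intro sum.cong) auto
  finally have "real d ^ n * w \<le> real d ^ n * (1 - \<epsilon>) + real (card U)" by (simp add: card_words)
  \<comment> \<open>The choice of \<epsilon> leaves exactly the gap N / \<gamma>, which
    \<open>U\<close> would have to fill.\<close>
  also have "real d ^ n * (1 - \<epsilon>) = real d ^ n * w - real N / \<gamma>"
    unfolding \<epsilon> w_def[symmetric] using dn \<gamma> by (simp add: field_simps)
  finally show False using U(2) by simp
qed

text \<open>Words in a decoding set have likelihood above \<gamma> and total probability at most 1,
  so there are at most 1 / \<gamma> of them. Hence \<open>k < N\<close> sets occupy fewer than N /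
  \<gamma> words, as \<open>feinstein_step\<close> demands. The target \<open>N\<close>, and with it
  \<epsilon>, stays fixed during the induction.\<close>

lemma feinstein_greedy:
  assumes \<gamma>: "\<gamma> > 0"
    and \<epsilon>: "\<epsilon> = 1 - wexp n (\<lambda>z. of_bool (mp n z > \<gamma>)) + real N / (\<gamma> * real d ^ n)"
    and "k \<le> N"
  shows "\<exists>\<phi> D. (\<forall>i\<in>{1..k}. \<phi> i \<in> words d n \<and> D i \<subseteq> {y \<in> words d n. W n y (\<phi> i) > \<gamma>}
            \<and> (\<Sum>y\<in>D i. W n y (\<phi> i)) \<ge> 1 - \<epsilon>)
       \<and> (\<forall>i\<in>{1..k}. \<forall>j\<in>{1..k}. i \<noteq> j \<longrightarrow> D i \<inter> D j = {})"
  using \<open>k \<le> N\<close>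
proof (induction k)
  case (Suc k)
  obtain \<phi> D where IH0: "(\<forall>i\<in>{1..k}. \<phi> i \<in> words d n \<and> D i \<subseteq> {y \<in> words d n. W n y (\<phi> i) > \<gamma>}
            \<and> (\<Sum>y\<in>D i. W n y (\<phi> i)) \<ge> 1 - \<epsilon>)
       \<and> (\<forall>i\<in>{1..k}. \<forall>j\<in>{1..k}. i \<noteq> j \<longrightarrow> D i \<inter> D j = {})"
    using Suc.IH[OF Suc_leD[OF Suc.prems]] by (elim exE) (rule that)
  have IH: "\<And>i. i \<in> {1..k} \<Longrightarrow> \<phi> i \<in> words d n"
     "\<And>i. i \<in> {1..k} \<Longrightarrow> D i \<subseteq> {y \<in> words d n. W n y (\<phi> i) > \<gamma>}"
     "\<And>i. i \<in> {1..k} \<Longrightarrow> (\<Sum>y\<in>D i. W n y (\<phi> i)) \<ge> 1 - \<epsilon>"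
     "\<And>i j. i \<in> {1..k} \<Longrightarrow> j \<in> {1..k} \<Longrightarrow> i \<noteq> j \<Longrightarrow> D i \<inter> D j = {}"
    using IH0 by simp_all
  define U where "U = (\<Union>i\<in>{1..k}. D i)"
  have card: "real (card (D i)) \<le> 1 / \<gamma>" if i: "i \<in> {1..k}" for i
  proof -
    have "real (card (D i)) * \<gamma> = (\<Sum>y\<in>D i. \<gamma>)" by simp
    also have "\<dots> \<le> (\<Sum>y\<in>D i. W n y (\<phi> i))" using IH(2)[OF i] by (intro sum_mono) auto
    also have "\<dots> \<le> (\<Sum>y\<in>words d n. W n y (\<phi> i))" using IH(2)[OF i] by (intro sum_mono2) (auto simp: W_nonneg)
    also have "\<dots> = 1" using sum_W_output[OF IH(1)[OF i], of "\<lambda>p. p"] sum_mp by simp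
    finally show ?thesis using \<gamma> by (simp add: field_simps)
  qed
  have "real (card U) \<le> (\<Sum>i\<in>{1..k}. real (card (D i)))"
    unfolding U_def by (metis card_UN_le finite_atLeastAtMost of_nat_le_iff of_nat_sum)
  also have "\<dots> \<le> (\<Sum>i\<in>{1..k}. 1 / \<gamma>)" by (intro sum_mono card)
  also have "\<dots> < real N / \<gamma>" using Suc.prems \<gamma> by (simp add: divide_strict_right_mono)
  finally obtain x where x: "x \<in> words d n" "(\<Sum>y\<in>{y \<in> words d n. W n y x > \<gamma>} - U. W n y x) \<ge> 1 - \<epsilon>"
    using feinstein_step[OF \<gamma> _ _ \<epsilon>, of U] IH(2) unfolding U_def by blast
  define B where "B = {y \<in> words d n. W n y x > \<gamma>} - U"
  have "\<forall>i\<in>{1..Suc k}. (\<phi>(Suc k := x)) i \<in> words d n \<and> (D(Suc k := B)) i \<subseteq> {y \<in> words d n. W n y ((\<phi>(Suc k := x)) i) > \<gamma>}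
            \<and> (\<Sum>y\<in>(D(Suc k := B)) i. W n y ((\<phi>(Suc k := x)) i)) \<ge> 1 - \<epsilon>"
  proof
    fix i assume "i \<in> {1..Suc k}"
    then consider "i = Suc k" | "i \<in> {1..k}" "i \<noteq> Suc k" by force
    then show "(\<phi>(Suc k := x)) i \<in> words d n \<and> (D(Suc k := B)) i \<subseteq> {y \<in> words d n. W n y ((\<phi>(Suc k := x)) i) > \<gamma>}
            \<and> (\<Sum>y\<in>(D(Suc k := B)) i. W n y ((\<phi>(Suc k := x)) i)) \<ge> 1 - \<epsilon>"
      by cases (use x IH in \<open>auto simp: B_def\<close>)
  qed
  moreover have "(D(Suc k := B)) i \<inter> (D(Suc k := B)) j = {}" if ij: "i \<in> {1..Suc k}" "j \<in> {1..Suc k}" "i \<noteq> j" for i j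
  proof -
    have BU: "B \<inter> D i = {}" if "i \<in> {1..k}" for i using that by (auto simp: B_def U_def)
    consider "i = Suc k" "j \<in> {1..k}" | "j = Suc k" "i \<in> {1..k}" | "i \<in> {1..k}" "j \<in> {1..k}"
      using ij by (auto simp: le_Suc_eq)
    then show ?thesis using ij(3) BU IH(4) by cases (auto simp: Int_commute)
  qed
  ultimately show ?case by blast
qed simp

lemma feinstein:
  assumes \<gamma>: "\<gamma> > 0" and N: "N \<ge> 1"
  shows "\<exists>\<phi> D. is_code d n N \<phi> D \<and>
    err_prob d Q s0 n N \<phi> D \<le> 1 - wexp n (\<lambda>z. of_bool (mp n z > \<gamma>)) + real N / (\<gamma> * real d ^ n)"
proof -
  define \<epsilon> where "\<epsilon> = 1 - wexp n (\<lambda>z. of_bool (mp n z > \<gamma>)) + real N / (\<gamma> * real d ^ n)"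
  obtain \<phi> D where code: "(\<forall>i\<in>{1..N}. \<phi> i \<in> words d n \<and> D i \<subseteq> {y \<in> words d n. W n y (\<phi> i) > \<gamma>}
            \<and> (\<Sum>y\<in>D i. W n y (\<phi> i)) \<ge> 1 - \<epsilon>)
       \<and> (\<forall>i\<in>{1..N}. \<forall>j\<in>{1..N}. i \<noteq> j \<longrightarrow> D i \<inter> D j = {})"
    using feinstein_greedy[OF \<gamma> \<epsilon>_def le_refl] by (elim exE) (rule that)
  have *: "\<And>i. i \<in> {1..N} \<Longrightarrow> \<phi> i \<in> words d n"
     "\<And>i. i \<in> {1..N} \<Longrightarrow> D i \<subseteq> {y \<in> words d n. W n y (\<phi> i) > \<gamma>}"
     "\<And>i. i \<in> {1..N} \<Longrightarrow> (\<Sum>y\<in>D i. W n y (\<phi> i)) \<ge> 1 - \<epsilon>"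
     "\<And>i j. i \<in> {1..N} \<Longrightarrow> j \<in> {1..N} \<Longrightarrow> i \<noteq> j \<Longrightarrow> D i \<inter> D j = {}"
    using code by simp_all
  have "is_code d n N \<phi> D" unfolding is_code_def using N * by blast
  moreover have "(\<Sum>i=1..N. 1 - (\<Sum>y\<in>D i. W n y (\<phi> i))) \<le> (\<Sum>i=1..N. \<epsilon>)"
    by (intro sum_mono) (use *(3) in force)
  then have "err_prob d Q s0 n N \<phi> D \<le> \<epsilon>"
    using N by (simp add: err_prob_def divide_le_eq mult.commute)
  ultimately show ?thesis unfolding \<epsilon>_def by blast
qed

lemma trivial_code: "\<exists>\<phi> D. is_code d n 1 \<phi> D \<and> err_prob d Q s0 n 1 \<phi> D = 0"
proof -
  \<comment> \<open>The zero word, produced with the value \<open>undefined\<close> outside the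
    index range as membership in \<open>words\<close> requires.\<close>
  define x where "x = sub_mod d n (\<lambda>_. 0) (\<lambda>_. 0)"
  have x: "x \<in> words d n" unfolding x_def by (rule sub_mod_words[OF d_gt_0])
  have "(\<Sum>y\<in>words d n. W n y x) = 1" using sum_W_output[OF x, of "\<lambda>p. p"] sum_mp by simp
  then have "is_code d n 1 (\<lambda>_. x) (\<lambda>_. words d n) \<and> err_prob d Q s0 n 1 (\<lambda>_. x) (\<lambda>_. words d n) = 0"
    using x by (simp add: is_code_def err_prob_def)
  then show ?thesis by blast
qed

text \<open>Away from null words the log-likelihood equals \<open>- S n z - n H\<close>, so a
  likelihood threshold becomes a threshold for \<open>- S\<close>.\<close>

lemma prob_le_threshold:
  assumes \<gamma>: "\<gamma> > 0"
  shows "1 - wexp n (\<lambda>z. of_bool (mp n z > \<gamma>)) = (wexp n (\<lambda>z. of_bool (- S n z \<le> real n * H + ln \<gamma>)) :: real)"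
proof -
  have "1 - wexp n (\<lambda>z. of_bool (mp n z > \<gamma>)) = wexp n (\<lambda>z. (1::real) - of_bool (mp n z > \<gamma>))"
    by (simp add: wexp_diff wexp_const)
  also have "\<dots> = (wexp n (\<lambda>z. of_bool (- S n z \<le> real n * H + ln \<gamma>)) :: real)"
    unfolding wexp_real
  proof (intro sum.cong refl)
    fix z assume z: "z \<in> words d n"
    show "mp n z * (1 - of_bool (mp n z > \<gamma>)) = mp n z * of_bool (- S n z \<le> real n * H + ln \<gamma>)"
    proof (cases "mp n z = 0")
      case False
      then have "mp n z > 0" using markov_prob_nonneg[OF z] by simp
      then have "mp n z > \<gamma> \<longleftrightarrow> ln (mp n z) > ln \<gamma>" using \<gamma> by simp
      then show ?thesis using ln_markov_prob[OF z False] by (auto simp: S_def)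
    qed simp
  qed
  finally show ?thesis .
qed

end

section \<open>Second-order asymptotics\<close>

text \<open>Bounds proved with a strict margin around \<open>a\<close> pass to \<open>a\<close>
  itself by continuity; it is used with \<open>r = -1\<close> for the converse and
  \<open>r = 1\<close> for achievability.\<close>

lemma Gauss_cdf_shift_tendsto:
  "(\<lambda>k. ereal (Gauss_cdf ((a + r / real (Suc k)) / v))) \<longlonglongrightarrow> ereal (Gauss_cdf (a / v))"
proof -
  have "(\<lambda>k. r / real (Suc k)) \<longlonglongrightarrow> 0" by (rule LIMSEQ_Suc) (rule lim_const_over_n)
  then have "(\<lambda>k. (a + r / real (Suc k)) * inverse v) \<longlonglongrightarrow> (a + 0) * inverse v"
    by (intro tendsto_intros)
  then have "(\<lambda>k. (a + r / real (Suc k)) / v) \<longlonglongrightarrow> a / v" by (simp add: divide_inverse)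
  from isCont_tendsto_compose[OF isCont_Gauss_cdf this] show ?thesis by simp
qed

text \<open>The polynomial factor in the likelihood thresholds shifts the exponent only by o(sqrt
  n), invisible at second order.\<close>

lemma ln_Suc_le_sqrt:
  assumes e: "e > 0"
  shows "\<forall>\<^sub>F n in sequentially. K + ln (real n + 1) \<le> e * sqrt (real n)"
proof -
  have "(\<lambda>n. (K + ln (real n + 1)) / sqrt (real n)) \<longlonglongrightarrow> 0" by real_asymp
  then have "\<forall>\<^sub>F n in sequentially. (K + ln (real n + 1)) / sqrt (real n) < e"
    using e by (rule order_tendstoD)
  then show ?thesis using eventually_gt_at_top[of 0]
    by eventually_elim (simp add: divide_less_eq less_imp_le)
qed

section \<open>Second-order converse and achievability\<close>

context markov_source
begin

abbreviation surprisal_dev_prob :: "nat \<Rightarrow> real \<Rightarrow> real" where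
  "surprisal_dev_prob n y \<equiv> wexp n (\<lambda>z. of_bool (- S n z \<le> y))"

lemma surprisal_dev_prob_mono: "y \<le> y' \<Longrightarrow> surprisal_dev_prob n y \<le> surprisal_dev_prob n y'"
  by (rule wexp_mono) auto

lemma surprisal_dev_prob_nonneg: "surprisal_dev_prob n y \<ge> 0"
  using wexp_mono[of n "\<lambda>_. 0" "\<lambda>z. of_bool (- S n z \<le> y)"] by (simp add: wexp_const)

lemma markov_clt_unscaled:
  assumes V: "V > 0"
  shows "(\<lambda>n. surprisal_dev_prob n (x * sqrt (real n))) \<longlonglongrightarrow> Gauss_cdf (x / sqrt V)"
proof -
  have "- S n z / sqrt (V * real n) \<le> x / sqrt V \<longleftrightarrow> - S n z \<le> x * sqrt (real n)" if "n \<ge> 1" for n z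
  proof -
    have "sqrt V > 0" "sqrt (real n) > 0" using V that by auto
    then show ?thesis by (simp add: real_sqrt_mult field_simps)
  qed
  then have "\<forall>\<^sub>F n in sequentially. wexp n (\<lambda>z. of_bool (- S n z / sqrt (V * real n) \<le> x / sqrt V))
     = surprisal_dev_prob n (x * sqrt (real n))"
    by (intro eventually_sequentiallyI[of 1]) simp
  then show ?thesis using markov_clt[OF V, of "x / sqrt V"] by (rule Lim_transform_eventually[rotated])
qed

lemma err_prob_ge:
  assumes code: "is_code d n N \<phi> D" and n: "n \<ge> 1"
  shows "err_prob d Q s0 n N \<phi> D \<ge>
    surprisal_dev_prob n (ln (real N) - real n * cap_AM d Q - ln (real n + 1)) - 1 / (real n + 1)"
proof -
  have N: "real N > 0" using code by (simp add: is_code_def)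
  have dn: "real d ^ n > 0" using d_gt_0 by simp
  \<comment> \<open>The factor n+1 makes the penalty in \<open>converse_bound\<close> equal to 1 /
    (n+1), at the cost of only ln (n+1) in the exponent.\<close>
  define \<gamma> where "\<gamma> = real N / (real d ^ n * (real n + 1))"
  have \<gamma>: "\<gamma> > 0" unfolding \<gamma>_def using N dn by simp
  have "ln \<gamma> = ln (real N) - real n * ln (real d) - ln (real n + 1)"
    using N dn d_gt_0 by (simp add: \<gamma>_def ln_div ln_mult ln_realpow)
  then have eq: "real n * H + ln \<gamma> = ln (real N) - real n * cap_AM d Q - ln (real n + 1)"
    by (simp add: cap_AM_def algebra_simps)
  have "\<gamma> * real d ^ n / real N = 1 / (real n + 1)" using N dn by (simp add: \<gamma>_def)
  then show ?thesis
    using converse_bound[OF code \<gamma>] unfolding prob_le_threshold[OF \<gamma>] eq by simp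
qed

text \<open>For \<open>c < a\<close> choose \<open>b\<close> in between: \<open>b < a\<close> turns
  the liminf condition into an eventual inequality, and the gap from \<open>c\<close> to
  \<open>b\<close> swallows ln (n+1). Then \<open>c\<close> tends to \<open>a\<close>.\<close>

lemma limsup_err_ge:
  assumes V: "V > 0" and code: "code_seq d N \<phi> D"
    and rate: "liminf (\<lambda>n. ereal (second_rate d Q N n)) \<ge> ereal a"
  shows "limsup (\<lambda>n. ereal (err_prob d Q s0 n (N n) (\<phi> n) (D n))) \<ge> ereal (Gauss_cdf (a / sqrt V))"
proof -
  let ?err = "\<lambda>n. err_prob d Q s0 n (N n) (\<phi> n) (D n)"
  have step: "ereal (Gauss_cdf (c / sqrt V)) \<le> limsup (\<lambda>n. ereal (?err n))" if "c < a" for c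
  proof -
    define b where "b = (a + c) / 2"
    have b: "b < a" "c < b" using that by (auto simp: b_def)
    have "ereal b < liminf (\<lambda>n. ereal (second_rate d Q N n))"
      using b(1) by (intro less_le_trans[OF _ rate]) simp
    then have e1: "\<forall>\<^sub>F n in sequentially. b < second_rate d Q N n" by (auto dest: less_LiminfD)
    have e2: "\<forall>\<^sub>F n in sequentially. 0 + ln (real n + 1) \<le> (b - c) * sqrt (real n)"
      using b by (intro ln_Suc_le_sqrt) auto
    have "\<forall>\<^sub>F n in sequentially. surprisal_dev_prob n (c * sqrt (real n)) - 1 / (real n + 1) \<le> ?err n"
      using e1 e2 eventually_ge_at_top[of 1]
    proof eventually_elim
      case (elim n)
      have "b * sqrt (real n) \<le> ln (real (N n)) - real n * cap_AM d Q"
        using elim(1,3) by (simp add: second_rate_def less_divide_eq)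
      then have "c * sqrt (real n) \<le> ln (real (N n)) - real n * cap_AM d Q - ln (real n + 1)"
        using elim(2) by (simp add: algebra_simps)
      from surprisal_dev_prob_mono[OF this, of n] show ?case
        using err_prob_ge[of n "N n" "\<phi> n" "D n"] code elim(3) by (simp add: code_seq_def)
    qed
    then have "liminf (\<lambda>n. ereal (surprisal_dev_prob n (c * sqrt (real n)) - 1 / (real n + 1))) \<le> liminf (\<lambda>n. ereal (?err n))"
      by (intro Liminf_mono) simp
    moreover have "(\<lambda>n. surprisal_dev_prob n (c * sqrt (real n)) - 1 / (real n + 1)) \<longlonglongrightarrow> Gauss_cdf (c / sqrt V) - 0"
      by (intro tendsto_diff markov_clt_unscaled V) real_asymp
    then have "liminf (\<lambda>n. ereal (surprisal_dev_prob n (c * sqrt (real n)) - 1 / (real n + 1))) = ereal (Gauss_cdf (c / sqrt V))"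
      by (intro lim_imp_Liminf) auto
    ultimately show ?thesis using Liminf_le_Limsup[of sequentially "\<lambda>n. ereal (?err n)"] by (auto intro: order_trans)
  qed
  show ?thesis
    by (rule LIMSEQ_le_const2[OF Gauss_cdf_shift_tendsto[of a "-1"]]) (auto intro!: step)
qed

text \<open>Feinstein's bound with the size just above the target. If the target log-size is not
  positive, a single codeword suffices, so a code is available for every \<open>n\<close>.\<close>

lemma code_exists:
  "\<exists>N \<phi> D. is_code d n N \<phi> D \<and> ln (real N) \<ge> real n * cap_AM d Q + a * sqrt (real n) \<and>
     err_prob d Q s0 n N \<phi> D \<le> surprisal_dev_prob n (a * sqrt (real n) + ln 2 + ln (real n + 1)) + 1 / (real n + 1)"
proof (cases "real n * cap_AM d Q + a * sqrt (real n) \<le> 0")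
  case True
  obtain \<phi> D where "is_code d n 1 \<phi> D" "err_prob d Q s0 n 1 \<phi> D = 0" using trivial_code[of n] by blast
  moreover have "0 \<le> surprisal_dev_prob n (a * sqrt (real n) + ln 2 + ln (real n + 1)) + 1 / (real n + 1)"
    by (intro add_nonneg_nonneg surprisal_dev_prob_nonneg) auto
  ultimately show ?thesis using True by (intro exI[of _ "1::nat"] exI[of _ \<phi>] exI[of _ D]) auto
next
  case False
  define R where "R = real n * cap_AM d Q + a * sqrt (real n)"
  define N where "N = nat \<lceil>exp R\<rceil>"
  have "exp R > 1" using False by (simp add: R_def)
  \<comment> \<open>Rounding up a number above 1 at most doubles it; this is the source of ln
    2.\<close>
  then have N: "exp R \<le> real N" "real N \<le> 2 * exp R" unfolding N_def by linarith+
  have "real N > 1" using N(1) \<open>exp R > 1\<close> by linarith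
  then have N1: "N \<ge> 1" "real N > 0" by auto
  have lnN: "R \<le> ln (real N)" "ln (real N) \<le> R + ln 2"
  proof -
    show "R \<le> ln (real N)" using N N1 by (simp add: ln_ge_iff)
    have "ln (real N) \<le> ln (2 * exp R)" using N N1 by (intro ln_mono) auto
    then show "ln (real N) \<le> R + ln 2" by (simp add: ln_mult)
  qed
  have dn: "real d ^ n > 0" using d_gt_0 by simp
  \<comment> \<open>Now the factor n+1 raises the threshold, so that the additive term of
    Feinstein's bound is 1 / (n+1).\<close>
  define \<gamma> where "\<gamma> = real N * (real n + 1) / real d ^ n"
  have \<gamma>: "\<gamma> > 0" unfolding \<gamma>_def using N1 dn by simp
  have "ln \<gamma> = ln (real N) + ln (real n + 1) - real n * ln (real d)"
    using N1 dn d_gt_0 by (simp add: \<gamma>_def ln_div ln_mult ln_realpow)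
  then have le: "real n * H + ln \<gamma> \<le> a * sqrt (real n) + ln 2 + ln (real n + 1)"
    using lnN(2) by (simp add: cap_AM_def R_def algebra_simps)
  have "real N / (\<gamma> * real d ^ n) = 1 / (real n + 1)" using N1 dn by (simp add: \<gamma>_def)
  then obtain \<phi> D where "is_code d n N \<phi> D"
    "err_prob d Q s0 n N \<phi> D \<le> surprisal_dev_prob n (real n * H + ln \<gamma>) + 1 / (real n + 1)"
    using feinstein[OF \<gamma> N1(1), of n] unfolding prob_le_threshold[OF \<gamma>] by auto
  then show ?thesis
    using surprisal_dev_prob_mono[OF le, of n] lnN(1) unfolding R_def
    by (intro exI[of _ N] exI[of _ \<phi>] exI[of _ D]) auto
qed

text \<open>One sequence attains the rate and the error together, so it serves both the infimum in
  \<open>CpAM\<close> and the supremum in \<open>CAM\<close>.\<close>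

lemma good_code_seq:
  assumes V: "V > 0"
  shows "\<exists>N \<phi> D. code_seq d N \<phi> D \<and> liminf (\<lambda>n. ereal (second_rate d Q N n)) \<ge> ereal a \<and>
    limsup (\<lambda>n. ereal (err_prob d Q s0 n (N n) (\<phi> n) (D n))) \<le> ereal (Gauss_cdf (a / sqrt V))"
proof -
  obtain N \<phi> D where code: "\<And>n. is_code d n (N n) (\<phi> n) (D n)"
    and rate: "\<And>n. ln (real (N n)) \<ge> real n * cap_AM d Q + a * sqrt (real n)"
    and err: "\<And>n. err_prob d Q s0 n (N n) (\<phi> n) (D n) \<le> surprisal_dev_prob n (a * sqrt (real n) + ln 2 + ln (real n + 1)) + 1 / (real n + 1)"
    using code_exists[of _ a] by metis
  let ?err = "\<lambda>n. err_prob d Q s0 n (N n) (\<phi> n) (D n)"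
  have "\<forall>\<^sub>F n in sequentially. ereal a \<le> ereal (second_rate d Q N n)"
    using eventually_gt_at_top[of 0]
  proof eventually_elim
    case (elim n)
    then show ?case using rate[of n] by (simp add: second_rate_def le_divide_eq)
  qed
  then have "ereal a \<le> liminf (\<lambda>n. ereal (second_rate d Q N n))" by (rule Liminf_bounded)
  moreover have step: "limsup (\<lambda>n. ereal (?err n)) \<le> ereal (Gauss_cdf (c / sqrt V))" if "a < c" for c
  proof -
    have e2: "\<forall>\<^sub>F n in sequentially. ln 2 + ln (real n + 1) \<le> (c - a) * sqrt (real n)"
      using that by (intro ln_Suc_le_sqrt) auto
    then have "\<forall>\<^sub>F n in sequentially. ereal (?err n) \<le> ereal (surprisal_dev_prob n (c * sqrt (real n)) + 1 / (real n + 1))"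
    proof eventually_elim
      case (elim n)
      then have "a * sqrt (real n) + ln 2 + ln (real n + 1) \<le> c * sqrt (real n)" by (simp add: algebra_simps)
      from surprisal_dev_prob_mono[OF this, of n] show ?case using err[of n] by simp
    qed
    then have "limsup (\<lambda>n. ereal (?err n)) \<le> limsup (\<lambda>n. ereal (surprisal_dev_prob n (c * sqrt (real n)) + 1 / (real n + 1)))"
      by (rule Limsup_mono)
    moreover have "(\<lambda>n. surprisal_dev_prob n (c * sqrt (real n)) + 1 / (real n + 1)) \<longlonglongrightarrow> Gauss_cdf (c / sqrt V) + 0"
      by (intro tendsto_add markov_clt_unscaled V) real_asymp
    then have "limsup (\<lambda>n. ereal (surprisal_dev_prob n (c * sqrt (real n)) + 1 / (real n + 1))) = ereal (Gauss_cdf (c / sqrt V))"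
      by (intro lim_imp_Limsup) auto
    ultimately show ?thesis by simp
  qed
  have "limsup (\<lambda>n. ereal (?err n)) \<le> ereal (Gauss_cdf (a / sqrt V))"
    by (rule LIMSEQ_le_const[OF Gauss_cdf_shift_tendsto[of a 1]]) (auto intro!: step)
  ultimately show ?thesis using code unfolding code_seq_def by blast
qed

lemma CpAM_eq:
  assumes V: "V > 0"
  shows "CpAM d Q s0 a = ereal (Gauss_cdf (a / sqrt V))"
proof (rule antisym)
  obtain N \<phi> D where c: "code_seq d N \<phi> D" "liminf (\<lambda>n. ereal (second_rate d Q N n)) \<ge> ereal a"
    "limsup (\<lambda>n. ereal (err_prob d Q s0 n (N n) (\<phi> n) (D n))) \<le> ereal (Gauss_cdf (a / sqrt V))"
    using good_code_seq[OF V] by blast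
  have "CpAM d Q s0 a \<le> limsup (\<lambda>n. ereal (err_prob d Q s0 n (N n) (\<phi> n) (D n)))"
    unfolding CpAM_def using c by (intro Inf_lower) blast
  then show "CpAM d Q s0 a \<le> ereal (Gauss_cdf (a / sqrt V))" using c(3) by (rule order_trans)
next
  show "ereal (Gauss_cdf (a / sqrt V)) \<le> CpAM d Q s0 a"
    unfolding CpAM_def by (rule Inf_greatest) (use limsup_err_ge[OF V] in blast)
qed

text \<open>At the claimed rate the Gaussian error equals \<epsilon>. A sequence with a larger rate
  would exceed some \<open>b\<close> above it, and \<open>limsup_err_ge\<close> with strict
  monotonicity would push its error beyond \<epsilon>.\<close>

lemma CAM_eq:
  assumes V: "V > 0" and e: "0 < \<epsilon>" "\<epsilon> < 1"
  shows "CAM d Q s0 \<epsilon> = ereal (sqrt V * Gauss_cdf_inv \<epsilon>)"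
proof (rule antisym)
  let ?a = "sqrt V * Gauss_cdf_inv \<epsilon>"
  have G: "Gauss_cdf (?a / sqrt V) = \<epsilon>" using V e by (simp add: Gauss_cdf_inv)
  show "CAM d Q s0 \<epsilon> \<le> ereal ?a"
    unfolding CAM_def
  proof (rule Sup_least, safe, rule ccontr)
    fix N \<phi> D
    assume c: "code_seq d N \<phi> D" "limsup (\<lambda>n. ereal (err_prob d Q s0 n (N n) (\<phi> n) (D n))) \<le> ereal \<epsilon>"
      "\<not> liminf (\<lambda>n. ereal (second_rate d Q N n)) \<le> ereal ?a"
    then obtain b where b: "ereal ?a < ereal b" "ereal b < liminf (\<lambda>n. ereal (second_rate d Q N n))"
      using ereal_dense2 not_le by blast
    have "ereal (Gauss_cdf (b / sqrt V)) \<le> ereal \<epsilon>"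
      using limsup_err_ge[OF V c(1) less_imp_le[OF b(2)]] c(2) by (rule order_trans)
    moreover have "?a / sqrt V < b / sqrt V" using b(1) V by (intro divide_strict_right_mono) auto
    ultimately show False using Gauss_cdf_strict_mono[of "?a / sqrt V" "b / sqrt V"] unfolding G by simp
  qed
  obtain N \<phi> D where c: "code_seq d N \<phi> D" "liminf (\<lambda>n. ereal (second_rate d Q N n)) \<ge> ereal ?a"
    "limsup (\<lambda>n. ereal (err_prob d Q s0 n (N n) (\<phi> n) (D n))) \<le> ereal \<epsilon>"
    using good_code_seq[OF V, of ?a] unfolding G by blast
  have "liminf (\<lambda>n. ereal (second_rate d Q N n)) \<le> CAM d Q s0 \<epsilon>"
    unfolding CAM_def using c by (intro Sup_upper) blast
  with c(2) show "ereal ?a \<le> CAM d Q s0 \<epsilon>" by (rule order_trans)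
qed

end

theorem theorem11:
  fixes d :: nat and Q :: "nat \<Rightarrow> nat \<Rightarrow> real" and s0 :: nat
  assumes "d \<ge> 1"
    and "irreducible_tm d Q"
    and "s0 < d"
    and "asym_var d Q s0 > 0"
  shows "(\<forall>a::real. CpAM d Q s0 a = ereal (Gauss_cdf (a / sqrt (asym_var d Q s0)))) \<and>
         (\<forall>\<epsilon>::real. 0 < \<epsilon> \<and> \<epsilon> < 1 \<longrightarrow>
            CAM d Q s0 \<epsilon> = ereal (sqrt (asym_var d Q s0) * Gauss_cdf_inv \<epsilon>))"
proof -
  interpret markov_source d Q s0 using assms by unfold_locales
  show ?thesis using CpAM_eq CAM_eq assms(4) unfolding asym_var_eq by blast
qed

end
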